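(* Let $\alpha>1$, $z_0>0$, and let $\rho,\kappa,\mu_1,\mu_2,\mu_3,\eta$ be as in the context; in particular $\rho_{j,j'}-\kappa_{j,j'}>2$ for all $j,j'$ and $$0\le \eta<\min\Big\{2\big(\tfrac1\nu-\mu_1\big)\eta_2-\mu_2,\ \eta_3\Big\}.$$ For $0<\varepsilon\ll1$ let $u$ be the solution of the Cauchy problem on $\mathbb R^d$ $$\mathrm i\partial_t u+\Delta u+\varepsilon^{\alpha}|u|^2u=0,\qquad u(0,x)=\sum_{n\in\mathbb Z^\nu}c(n)\,g_n\,e^{\mathrm i\theta_n(x)} .$$ Put $\beta=\alpha-1-\frac32\eta-\frac{\mu_3}{2}$ and let the observation time $t=t_\varepsilon>0$ satisfy $t=\mathcal O(\varepsilon^{-\beta})$ as $\varepsilon\to0^+$. Then $$\lim_{\varepsilon\to0^+}\varepsilon\log\mathbb P\Big(\sup_{x\in\mathbb R^d}|u(t,x)|>z_0\,\varepsilon^{-1/2}\Big)=-\frac{z_0^2}{\sum_{n\in\mathbb Z^\nu}|c(n)|^2}.$$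
   Context: Let $d\ge1$, let $\nu_1,\dots,\nu_d\ge1$ be integers and $\nu=\sum_{j=1}^d\nu_j>d$. Write $n\in\mathbb Z^\nu$ as $n=(n_1,\dots,n_d)$ with $n_j=(n_{j,1},\dots,n_{j,\nu_j})\in\mathbb Z^{\nu_j}$. For each $j$ fix a frequency vector $\omega_j\in\mathbb R^{\nu_j}$ that is rationally independent: $\langle m,\omega_j\rangle=0$ with $m\in\mathbb Z^{\nu_j}$ implies $m=0$. For $x\in\mathbb R^d$ put $\theta_n(x)=\sum_{j=1}^d\langle n_j,\omega_j\rangle x_j$, and put $Q(n)=\sum_{j=1}^d\langle n_j,\omega_j\rangle^2$. For a vector of real exponents $\tau=(\tau_{j,j'})_{1\le j\le d,\,1\le j'\le\nu_j}$ set $w_\tau(n)=\prod_{j=1}^d\prod_{j'=1}^{\nu_j}(1+|n_{j,j'}|)^{\tau_{j,j'}}$. Random data: $c:\mathbb Z^\nu\to\mathbb C$ is deterministic, not identically zero, with $|c(n)|\le w_{-\rho}(n)$, where all $\rho_{j,j'}>0$. On a probability space $(\Omega,\mathcal F,\mathbb P)$, $(g_n)_{n\in\mathbb Z^\nu}$ are i.i.d. standard complex Gaussian variables (real and imaginary parts independent $\mathcal N(0,\frac12)$). Parameters: $\kappa=(\kappa_{j,j'})$ with all $\kappa_{j,j'}>0$ and $\rho_{j,j'}-\kappa_{j,j'}>2$; $0<\mu_1\ll 1/\nu$, $0<\mu_2\ll1$, $0<\mu_3\ll1$ are fixed small constants (in particular $\mu_1<1/\nu$); $\eta_2=\sum_{j=1}^d\sum_{j'=1}^{\nu_j}(\rho_{j,j'}-\kappa_{j,j'}-1)$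 and $\eta_3=\frac23(\alpha-1)-\frac{\mu_3}{3}$. Solution: $u(t,x)=\sum_{n}c(t,n)e^{\mathrm i\theta_n(x)}$ is the spatially quasi-periodic solution whose Fourier coefficients are absolutely summable (continuous in time with values in $\ell^1(\mathbb Z^\nu)$) and satisfy, for all $n\in\mathbb Z^\nu$, $$c(t,n)=e^{-\mathrm iQ(n)t}c(n)g_n+\mathrm i\varepsilon^\alpha\int_0^te^{-\mathrm iQ(n)(t-s)}\sum_{n^1-n^2+n^3=n}c(s,n^1)\overline{c(s,n^2)}c(s,n^3)\,ds .$$ If for some $\omega\in\Omega$ no such solution exists up to the observation time, then membership of $\omega$ in the event may be prescribed arbitrarily (measurably). *)

theory Defs
  imports "HOL-Probability.Probability" "HOL-Library.Landau_Symbols"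
begin

text \<open>
  The lattice of the \<open>n = (n\<^sub>1, \<dots>, n\<^sub>d)\<close> with \<open>n\<^sub>j\<close> an integer vector of length \<open>\<nu>\<^sub>j\<close> is
  the type \<^typ>\<open>int ^ 'k\<close>, where the finite type \<open>'k\<close> enumerates all index pairs \<open>(j, j')\<close>
  and a surjection \<open>blk :: 'k \<Rightarrow> 'd\<close> sends \<open>(j, j')\<close> to its block \<open>j\<close>.
  So \<open>d = CARD('d)\<close>, \<open>\<nu>\<^sub>j = card (blk -` {j})\<close>, \<open>\<nu> = CARD('k)\<close>; surjectivity of \<open>blk\<close>
  says that every \<open>\<nu>\<^sub>j\<close> is at least 1, and every choice of \<open>d\<close> and \<open>\<nu>\<^sub>1, \<dots>, \<nu>\<^sub>d\<close> arises.
  The frequency vectors are likewise collected in one \<open>freq :: real ^ 'k\<close>,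
  whose restriction to block \<open>j\<close> is \<open>\<omega>\<^sub>j\<close>.
\<close>

text \<open>\<open>\<langle>n\<^sub>j, \<omega>\<^sub>j\<rangle>\<close>\<close>

definition block_inner :: "('k::finite \<Rightarrow> 'd::finite) \<Rightarrow> real ^ 'k \<Rightarrow> int ^ 'k \<Rightarrow> 'd \<Rightarrow> real" where
  "block_inner blk freq n j = (\<Sum>k | blk k = j. real_of_int (n $ k) * freq $ k)"

text \<open>Only the components of \<open>m\<close> in block \<open>j\<close> matter below, so \<open>m\<close> ranges over
  all integer vectors of length \<open>\<nu>\<^sub>j\<close>.\<close>

definition rationally_independent_blocks :: "('k::finite \<Rightarrow> 'd::finite) \<Rightarrow> real ^ 'k \<Rightarrow> bool" where
  "rationally_independent_blocks blk freq \<longleftrightarrow>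
     (\<forall>j. \<forall>m :: int ^ 'k. block_inner blk freq m j = 0 \<longrightarrow> (\<forall>k. blk k = j \<longrightarrow> m $ k = 0))"

definition theta :: "('k::finite \<Rightarrow> 'd::finite) \<Rightarrow> real ^ 'k \<Rightarrow> int ^ 'k \<Rightarrow> real ^ 'd \<Rightarrow> real" where
  "theta blk freq n x = (\<Sum>j\<in>UNIV. block_inner blk freq n j * x $ j)"

definition Qform :: "('k::finite \<Rightarrow> 'd::finite) \<Rightarrow> real ^ 'k \<Rightarrow> int ^ 'k \<Rightarrow> real" where
  "Qform blk freq n = (\<Sum>j\<in>UNIV. (block_inner blk freq n j)\<^sup>2)"

definition weight :: "real ^ 'k \<Rightarrow> int ^ 'k::finite \<Rightarrow> real" where
  "weight \<tau> n = (\<Prod>k\<in>UNIV. (1 + \<bar>real_of_int (n $ k)\<bar>) powr (\<tau> $ k))"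

text \<open>The second parameter of \<^const>\<open>normal_density\<close> is the standard deviation.\<close>

definition (in prob_space) std_complex_gaussian :: "('a \<Rightarrow> complex) \<Rightarrow> bool" where
  "std_complex_gaussian X \<longleftrightarrow>
     random_variable borel X \<and>
     distributed M lborel (\<lambda>w. Re (X w)) (normal_density 0 (sqrt (1 / 2))) \<and>
     distributed M lborel (\<lambda>w. Im (X w)) (normal_density 0 (sqrt (1 / 2))) \<and>
     indep_var borel (\<lambda>w. Re (X w)) borel (\<lambda>w. Im (X w))"

definition cubic_conv :: "(int ^ 'k::finite \<Rightarrow> complex) \<Rightarrow> int ^ 'k \<Rightarrow> complex" where
  "cubic_conv b n =
     (\<Sum>\<^sub>\<infinity>(n1, n2, n3) \<in> {(n1, n2, n3). n1 - n2 + n3 = n}. b n1 * cnj (b n2) * b n3)"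

text \<open>Continuity on \<open>[0, T]\<close> with values in \<open>\<ell>\<^sup>1\<close>.\<close>

definition l1_continuous_on :: "real \<Rightarrow> (real \<Rightarrow> 'i \<Rightarrow> complex) \<Rightarrow> bool" where
  "l1_continuous_on T C \<longleftrightarrow>
     (\<forall>s\<in>{0..T}. (\<lambda>n. cmod (C s n)) summable_on UNIV) \<and>
     (\<forall>s\<in>{0..T}. ((\<lambda>r. \<Sum>\<^sub>\<infinity>n. cmod (C r n - C s n)) \<longlongrightarrow> 0) (at s within {0..T}))"

text \<open>
  \<open>C s n\<close> is the Fourier coefficient \<open>c(s, n)\<close> on \<open>[0, T]\<close> of the quasi-periodic solution with
  initial coefficients \<open>a n\<close>. Values of \<open>C\<close> outside \<open>[0, T]\<close> are irrelevant.
\<close>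

definition nls_solution ::
  "('k::finite \<Rightarrow> 'd::finite) \<Rightarrow> real ^ 'k \<Rightarrow> real \<Rightarrow> real \<Rightarrow> real \<Rightarrow>
   (int ^ 'k \<Rightarrow> complex) \<Rightarrow> (real \<Rightarrow> int ^ 'k \<Rightarrow> complex) \<Rightarrow> bool" where
  "nls_solution blk freq \<alpha> \<epsilon> T a C \<longleftrightarrow>
     l1_continuous_on T C \<and>
     (\<forall>s\<in>{0..T}. \<forall>n.
        C s n = exp (- \<i> * of_real (Qform blk freq n * s)) * a n
          + \<i> * of_real (\<epsilon> powr \<alpha>) *
            integral {0..s} (\<lambda>r. exp (- \<i> * of_real (Qform blk freq n * (s - r))) * cubic_conv (C r) n))"

definition quasi_periodic ::
  "('k::finite \<Rightarrow> 'd::finite) \<Rightarrow> real ^ 'k \<Rightarrow> (int ^ 'k \<Rightarrow> complex) \<Rightarrow> real ^ 'd \<Rightarrow> complex" where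
  "quasi_periodic blk freq b x = (\<Sum>\<^sub>\<infinity>n. b n * exp (\<i> * of_real (theta blk freq n x)))"

text \<open>
  \<open>E\<close> is the event that \<open>sup\<^sub>x |u(T, x)| > z\<close> for the solution \<open>u\<close> with random initial
  coefficients \<open>c(n) g\<^sub>n\<close>. For outcomes without a solution up to time \<open>T\<close>, membership in \<open>E\<close>
  is arbitrary, subject only to measurability of \<open>E\<close>. Solutions are unique on \<open>[0, T]\<close>, so the
  quantifier over \<open>C\<close> only names the solution. The supremum is over a bounded set.
\<close>

definition sup_exceeds_event ::
  "'w measure \<Rightarrow> ('k::finite \<Rightarrow> 'd::finite) \<Rightarrow> real ^ 'k \<Rightarrow> real \<Rightarrow> real \<Rightarrow> real \<Rightarrow>
   (int ^ 'k \<Rightarrow> complex) \<Rightarrow> (int ^ 'k \<Rightarrow> 'w \<Rightarrow> complex) \<Rightarrow> real \<Rightarrow> 'w set \<Rightarrow> bool" where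
  "sup_exceeds_event M blk freq \<alpha> \<epsilon> T c g z E \<longleftrightarrow>
     E \<in> sets M \<and>
     (\<forall>w\<in>space M. \<forall>C. nls_solution blk freq \<alpha> \<epsilon> T (\<lambda>n. c n * g n w) C \<longrightarrow>
        (w \<in> E \<longleftrightarrow> (SUP x. cmod (quasi_periodic blk freq (C T) x)) > z))"

text \<open>
  A limit statement of the form \<open>\<epsilon> * ln (measure M (E \<epsilon>)) \<longlongrightarrow> L\<close> with \<open>L < 0\<close> is not affected by the
  convention \<open>ln 0 = 0\<close>: it forces the probabilities to be positive for small \<open>\<epsilon>\<close>.
\<close>

end

theory Submission
  imports Defs "HOL-Real_Asymp.Real_Asymp"
begin

text \<open>
  On times \<open>t = O(\<epsilon>\<^bsup>-\<beta>\<^esup>)\<close> the nonlinearity is a perturbation: if the initial coefficients have \<open>\<ell>\<^sup>1\<close> norm at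
  most \<open>K \<epsilon>\<^bsup>-1/2\<^esup>\<close>, then \<open>\<epsilon>\<^bsup>\<alpha>\<^esup> t K\<^sup>2 \<epsilon>\<^bsup>-1\<^esup> \<rightarrow> 0\<close>, the solution exists up to time \<open>t\<close> and differs from the linear
  evolution by \<open>o(\<epsilon>\<^bsup>-1/2\<^esup>)\<close> in \<open>\<ell>\<^sup>1\<close>.

  For the upper bound the supremum is estimated by the \<open>\<ell>\<^sup>1\<close> norm \<open>\<Sum> \<bar>c n\<bar> \<bar>g n\<bar>\<close>, which loses nothing on the
  logarithmic scale: with weights \<open>v = 1\<close> on a large finite set and \<open>v = \<bar>c\<bar>\<close> off it, Cauchy--Schwarz gives
  \<open>(\<Sum> \<bar>c\<bar> \<bar>g\<bar>)\<^sup>2 \<le> (\<Sum> \<bar>c\<bar>\<^sup>2 + \<delta>) (\<Sum> v \<bar>g\<bar>\<^sup>2)\<close>, and \<open>\<Sum> v \<bar>g\<bar>\<^sup>2\<close> has exponential moments of every order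
  below 1. The same estimate shows that large \<open>\<ell>\<^sup>1\<close> norms are negligible.

  For the lower bound the supremum is at least the value at \<open>x = 0\<close>, whose linear part is a Gaussian sum;
  the terms off a large finite set are again negligible by the \<open>\<ell>\<^sup>1\<close> tail bound.
\<close>

subsection \<open>Infinite sums\<close>

text \<open>Dominated convergence for unordered sums along a filter: the Weierstrass M-test makes
  the finite partial sums converge uniformly on \<open>Y\<close>, which permits exchanging the two
  limits. It serves for continuity in time as well as for limits of iterates.\<close>

lemma tendsto_infsum_dominated:
  fixes f :: "'a \<Rightarrow> 'b \<Rightarrow> 'c::banach"
  assumes lim: "\<And>x. x \<in> X \<Longrightarrow> ((\<lambda>y. f x y) \<longlongrightarrow> g x) G"
    and bound: "\<And>x y. x \<in> X \<Longrightarrow> y \<in> Y \<Longrightarrow> norm (f x y) \<le> B x"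
    and B: "B summable_on X"
    and ev: "\<forall>\<^sub>F y in G. y \<in> Y" and G: "G \<noteq> bot"
  shows "((\<lambda>y. \<Sum>\<^sub>\<infinity>x\<in>X. f x y) \<longlongrightarrow> (\<Sum>\<^sub>\<infinity>x\<in>X. g x)) G"
proof (rule swap_uniform_limit')
  show "\<forall>\<^sub>F F in finite_subsets_at_top X. ((\<lambda>y. \<Sum>x\<in>F. f x y) \<longlongrightarrow> (\<Sum>x\<in>F. g x)) G"
    using lim by (auto intro!: eventually_finite_subsets_at_top_weakI tendsto_sum)
  have "norm (g x) \<le> B x" if "x \<in> X" for x
    using tendsto_norm[OF lim[OF that]] eventually_mono[OF ev bound[OF that]] G
    by (rule tendsto_upperbound)
  then have "(\<lambda>x. norm (g x)) summable_on X"
    by (rule Infinite_Sum.abs_summable_on_comparison_test'[OF B])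
  then have "g summable_on X" by (rule abs_summable_summable)
  then show "(sum g \<longlongrightarrow> (\<Sum>\<^sub>\<infinity>x\<in>X. g x)) (finite_subsets_at_top X)"
    by (rule infsum_tendsto)
  show "uniform_limit Y (\<lambda>F y. \<Sum>x\<in>F. f x y) (\<lambda>y. \<Sum>\<^sub>\<infinity>x\<in>X. f x y) (finite_subsets_at_top X)"
    by (rule Weierstrass_m_test_general[OF bound B])
qed (use ev in auto)

lemma has_sum_diff:
  fixes f g :: "'a \<Rightarrow> 'b::real_normed_vector"
  assumes "(f has_sum a) A" and "(g has_sum b) A"
  shows "((\<lambda>x. f x - g x) has_sum (a - b)) A"
  using has_sum_add[OF assms(1), of "\<lambda>x. - g x" "- b"] assms(2) by (simp add: has_sum_uminus)

lemma has_sum_product: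
  fixes f :: "'a \<Rightarrow> real" and g :: "'b \<Rightarrow> real"
  assumes f: "(f has_sum a) UNIV" and g: "(g has_sum b) UNIV"
    and nn: "\<And>x. 0 \<le> f x" "\<And>y. 0 \<le> g y"
  shows "((\<lambda>(x, y). f x * g y) has_sum (a * b)) UNIV"
proof -
  have inner: "((\<lambda>y. f x * g y) has_sum (f x * b)) UNIV" for x
    using g by (rule has_sum_cmult_right)
  have outer: "((\<lambda>x. f x * b) has_sum (a * b)) UNIV"
    using f by (rule has_sum_cmult_left)
  have "(\<lambda>(x, y). f x * g y) summable_on (SIGMA x:UNIV. UNIV)"
    by (rule summable_on_SigmaI[where g = "\<lambda>x. f x * b"])
      (use inner has_sum_imp_summable[OF outer] nn in auto)
  then have "((\<lambda>(x, y). f x * g y) has_sum (a * b)) (SIGMA x:UNIV. UNIV)"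
    by (intro has_sum_SigmaI[OF _ outer]) (use inner in auto)
  then show ?thesis by simp
qed

text \<open>Telescoping: each of the two new terms is at most 1/(N+1) - 1/(N+2). The constant 3
  makes the bound an equality at \<open>N = 0\<close>.\<close>

lemma sum_inverse_powr_le:
  assumes r: "2 \<le> r"
  shows "(\<Sum>m\<in>{- int N..int N}. (1 + \<bar>real_of_int m\<bar>) powr - r) \<le> 3 - 2 / (real N + 1)"
proof (induction N)
  case (Suc N)
  have "(real N + 2) powr - r \<le> (real N + 2) powr - 2"
    using r by (intro powr_mono) auto
  also have "\<dots> = 1 / (real N + 2)\<^sup>2"
    by (simp add: powr_minus powr_numeral inverse_eq_divide)
  also have "\<dots> \<le> 1 / ((real N + 1) * (real N + 2))"
    unfolding power2_eq_square by (intro divide_left_mono mult_right_mono mult_pos_pos) auto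
  also have "\<dots> = 1 / (real N + 1) - 1 / (real N + 2)"
    by (simp add: divide_simps)
  finally have step: "(real N + 2) powr - r \<le> 1 / (real N + 1) - 1 / (real N + 2)" .
  have "{- int (Suc N)..int (Suc N)} = insert (- int (Suc N)) (insert (int (Suc N)) {- int N..int N})"
    by auto
  then have "(\<Sum>m\<in>{- int (Suc N)..int (Suc N)}. (1 + \<bar>real_of_int m\<bar>) powr - r)
      = 2 * (real N + 2) powr - r + (\<Sum>m\<in>{- int N..int N}. (1 + \<bar>real_of_int m\<bar>) powr - r)"
    by (simp add: add.commute)
  with Suc.IH step show ?case by (simp add: add.commute)
qed simp

section \<open>Summability and boundedness of the polynomial weights\<close>

lemma weight_nonneg: "0 \<le> weight \<tau> n"
  by (simp add: weight_def prod_nonneg)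

text \<open>A finite set of lattice points lies in a cube, over which the sum of a product weight
  factorizes into one-dimensional sums, each at most 3.\<close>

lemma weight_summable:
  fixes \<rho> :: "real ^ 'k::finite"
  assumes \<rho>: "\<And>k. 2 \<le> \<rho> $ k"
  shows "weight (- \<rho>) summable_on UNIV"
proof (rule nonneg_bdd_above_summable_on[OF weight_nonneg], rule bdd_aboveI2)
  fix F :: "(int ^ 'k) set" assume "F \<in> {F. F \<subseteq> UNIV \<and> finite F}"
  then have F: "finite F" by simp
  \<comment> \<open>Half the side of a cube containing \<open>F\<close>; inserting 0 keeps
    \<open>Max\<close> meaningful for empty \<open>F\<close>.\<close>
  define N where "N = nat (Max (insert 0 ((\<lambda>(n, k). \<bar>n $ k\<bar>) ` (F \<times> UNIV))))"
  have N: "\<bar>n $ k\<bar> \<le> int N" if "n \<in> F" for n k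
  proof -
    have "\<bar>n $ k\<bar> \<le> Max (insert 0 ((\<lambda>(n, k). \<bar>n $ k\<bar>) ` (F \<times> UNIV)))"
      using F that by (intro Max_ge) (auto simp: image_iff)
    then show ?thesis unfolding N_def by linarith
  qed
  let ?h = "\<lambda>k m. (1 + \<bar>real_of_int m\<bar>) powr - (\<rho> $ k)"
  have "sum (weight (- \<rho>)) F = (\<Sum>f\<in>vec_nth ` F. \<Prod>k\<in>UNIV. ?h k (f k))"
    by (subst sum.reindex) (auto simp: inj_on_def vec_nth_inject weight_def)
  also have "\<dots> \<le> (\<Sum>f\<in>PiE UNIV (\<lambda>_. {- int N..int N}). \<Prod>k\<in>UNIV. ?h k (f k))"
  proof (rule sum_mono2)
    show "finite (PiE (UNIV :: 'k set) (\<lambda>_. {- int N..int N}))" by (intro finite_PiE) auto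
    have "- int N \<le> n $ k \<and> n $ k \<le> int N" if "n \<in> F" for n k
      using N[OF that, of k] by linarith
    then show "vec_nth ` F \<subseteq> PiE UNIV (\<lambda>_. {- int N..int N})" by auto
  qed (simp add: prod_nonneg)
  also have "\<dots> = (\<Prod>k\<in>UNIV. \<Sum>m\<in>{- int N..int N}. ?h k m)"
    by (rule prod_sum_PiE[symmetric]) auto
  also have "\<dots> \<le> (\<Prod>k\<in>(UNIV::'k set). 3)"
  proof (intro prod_mono conjI sum_nonneg)
    fix k
    have "(\<Sum>m\<in>{- int N..int N}. ?h k m) \<le> 3 - 2 / (real N + 1)"
      by (rule sum_inverse_powr_le[OF \<rho>])
    also have "\<dots> \<le> 3" by simp
    finally show "(\<Sum>m\<in>{- int N..int N}. ?h k m) \<le> 3" .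
  qed simp
  finally show "sum (weight (- \<rho>)) F \<le> 3 ^ CARD('k)" by simp
qed

lemma weight_le_1:
  assumes "\<And>k. 0 \<le> \<rho> $ k"
  shows "weight (- \<rho>) n \<le> 1"
  unfolding weight_def
proof (rule prod_le_1)
  fix k
  have "(1 + \<bar>real_of_int (n $ k)\<bar>) powr - (\<rho> $ k) \<le> (1 + \<bar>real_of_int (n $ k)\<bar>) powr 0"
    using assms by (intro powr_mono) auto
  moreover have "1 + \<bar>real_of_int (n $ k)\<bar> \<noteq> 0" by linarith
  ultimately show "0 \<le> (1 + \<bar>real_of_int (n $ k)\<bar>) powr (- \<rho>) $ k \<and>
      (1 + \<bar>real_of_int (n $ k)\<bar>) powr (- \<rho>) $ k \<le> 1"
    by simp
qed

subsection \<open>The cubic convolution\<close>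

definition triples :: "'i::ab_group_add \<Rightarrow> ('i \<times> 'i \<times> 'i) set" where
  "triples n = {(n1, n2, n3). n1 - n2 + n3 = n}"

definition cubic_majorant :: "('i::ab_group_add \<Rightarrow> real) \<Rightarrow> 'i \<Rightarrow> real" where
  "cubic_majorant B n = (\<Sum>\<^sub>\<infinity>(n1, n2, n3)\<in>triples n. B n1 * B n2 * B n3)"

lemma triple_product_has_sum:
  fixes B :: "'i \<Rightarrow> real"
  assumes "\<And>n. 0 \<le> B n" and "(B has_sum s) UNIV"
  shows "((\<lambda>(n1, n2, n3). B n1 * B n2 * B n3) has_sum s ^ 3) UNIV"
proof -
  have "((\<lambda>(n2, n3). B n2 * B n3) has_sum (s * s)) UNIV"
    by (rule has_sum_product) (use assms in auto)
  then have "((\<lambda>(n1, p). B n1 * (\<lambda>(n2, n3). B n2 * B n3) p) has_sum (s * (s * s))) UNIV"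
    by (intro has_sum_product) (use assms in auto)
  then show ?thesis
    by (simp add: case_prod_unfold power3_eq_cube mult.assoc)
qed

lemma triple_product_summable:
  fixes B :: "'i \<Rightarrow> real"
  assumes "\<And>n. 0 \<le> B n" and "B summable_on UNIV"
  shows "(\<lambda>(n1, n2, n3). B n1 * B n2 * B n3) summable_on X"
  using triple_product_has_sum[OF assms(1) has_sum_infsum[OF assms(2)]]
  by (rule summable_on_subset_banach[OF has_sum_imp_summable]) auto

lemma cubic_majorant_has_sum:
  fixes B :: "'i::ab_group_add \<Rightarrow> real"
  assumes nn: "\<And>n. 0 \<le> B n" and B: "(B has_sum s) UNIV"
  shows "(cubic_majorant B has_sum s ^ 3) UNIV"
proof -
  let ?f = "\<lambda>(n1, n2, n3). B n1 * B n2 * B n3"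
  have "inj_on snd (SIGMA n:(UNIV :: 'i set). triples n)"
  \<comment> \<open>The inverse recovers \<open>n\<close> from the triple as
    \<open>n1 - n2 + n3\<close>.\<close>
  proof (rule inj_on_inverseI[where g = "\<lambda>p. (fst p - fst (snd p) + snd (snd p), p)"])
    fix q :: "'i \<times> 'i \<times> 'i \<times> 'i" assume "q \<in> (SIGMA n:UNIV. triples n)"
    then have "snd q \<in> triples (fst q)" by (elim SigmaE) simp
    then have "fst (snd q) - fst (snd (snd q)) + snd (snd (snd q)) = fst q"
      unfolding triples_def case_prod_unfold by (rule CollectD)
    then show "(fst (snd q) - fst (snd (snd q)) + snd (snd (snd q)), snd q) = q" by simp
  qed
  moreover have "p \<in> snd ` (SIGMA n:UNIV. triples n)" for p :: "'i \<times> 'i \<times> 'i"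
  proof -
    obtain x y z where "p = (x, y, z)" by (rule prod_cases3)
    then show ?thesis unfolding triples_def by (intro image_eqI[of _ _ "(x - y + z, p)"]) simp_all
  qed
  ultimately have "bij_betw snd (SIGMA n:UNIV. triples n) (UNIV :: ('i \<times> 'i \<times> 'i) set)"
    unfolding bij_betw_def by blast
  from has_sum_reindex_bij_betw[OF this, of ?f "s ^ 3"]
  have sum: "((\<lambda>p. ?f (snd p)) has_sum s ^ 3) (SIGMA n:UNIV. triples n)"
    using triple_product_has_sum[OF nn B] by simp
  have "(?f has_sum cubic_majorant B n) (triples n)" for n
    unfolding cubic_majorant_def
    by (rule has_sum_infsum, rule triple_product_summable)
      (use nn B in \<open>auto intro: has_sum_imp_summable\<close>)
  then show ?thesis
    by (intro has_sum_SigmaD[OF sum]) (simp only: snd_conv)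
qed

lemma cubic_majorant_mono:
  assumes "\<And>n. 0 \<le> B' n" and "\<And>n. B' n \<le> B n" and "B summable_on UNIV"
  shows "cubic_majorant B' n \<le> cubic_majorant B n"
proof -
  have nn: "0 \<le> B m" for m using assms(1)[of m] assms(2)[of m] by linarith
  have "B' summable_on UNIV"
    by (rule summable_on_comparison_test[OF assms(3)]) (use assms in auto)
  then show ?thesis
    unfolding cubic_majorant_def using assms nn
    by (intro infsum_mono triple_product_summable)
      (auto intro!: mult_mono mult_nonneg_nonneg split: prod.splits)
qed

lemma cubic_majorant_nonneg:
  assumes "\<And>n. 0 \<le> B n"
  shows "0 \<le> cubic_majorant B n"
  unfolding cubic_majorant_def using assms
  by (intro infsum_nonneg) (auto split: prod.splits)

lemma cubic_conv_summand_bound: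
  fixes b :: "'i \<Rightarrow> complex"
  assumes "\<And>n. cmod (b n) \<le> B n"
  shows "cmod ((\<lambda>(n1, n2, n3). b n1 * cnj (b n2) * b n3) p) \<le> (\<lambda>(n1, n2, n3). B n1 * B n2 * B n3) p"
proof -
  have "0 \<le> B n" for n using assms[of n] norm_ge_zero order_trans by blast
  then show ?thesis
    using assms by (auto simp: norm_mult intro!: mult_mono split: prod.splits)
qed

lemma cubic_conv_summable:
  fixes b :: "'i \<Rightarrow> complex"
  assumes bound: "\<And>n. cmod (b n) \<le> B n" and B: "B summable_on UNIV"
  shows "(\<lambda>(n1, n2, n3). b n1 * cnj (b n2) * b n3) summable_on X"
proof -
  have "0 \<le> B n" for n using bound[of n] norm_ge_zero order_trans by blast
  from triple_product_summable[OF this B] show ?thesis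
    by (rule abs_summable_summable[OF Infinite_Sum.abs_summable_on_comparison_test'])
      (rule cubic_conv_summand_bound[OF bound])
qed

lemma cubic_conv_eq:
  "cubic_conv b n = (\<Sum>\<^sub>\<infinity>p\<in>triples n. (\<lambda>(n1, n2, n3). b n1 * cnj (b n2) * b n3) p)"
  by (simp add: cubic_conv_def triples_def)

lemma norm_cubic_conv_le:
  assumes bound: "\<And>n. cmod (b n) \<le> B n" and B: "B summable_on UNIV"
  shows "cmod (cubic_conv b n) \<le> cubic_majorant B n"
proof -
  have nn: "0 \<le> B n" for n using bound[of n] norm_ge_zero order_trans by blast
  show ?thesis
    unfolding cubic_conv_eq cubic_majorant_def
    by (rule norm_infsum_le[OF has_sum_infsum has_sum_infsum])
      (use cubic_conv_summand_bound[OF bound] cubic_conv_summable[OF bound B]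
         triple_product_summable[OF nn B] in auto)
qed

text \<open>Changing one factor at a time, the bounds on the three resulting terms telescope to
  exactly \<open>B x * B y * B z - B' x * B' y * B' z\<close>. Hence increments of the convolution
  are controlled by increments of the majorant, the form that the Picard iteration
  propagates.\<close>

lemma norm_cubic_conv_diff_le:
  assumes bound: "\<And>n. cmod (b n) \<le> B n" and B: "B summable_on UNIV"
    and bound': "\<And>n. cmod (b' n) \<le> B' n"
    and diff: "\<And>n. cmod (b n - b' n) \<le> B n - B' n"
  shows "cmod (cubic_conv b n - cubic_conv b' n) \<le> cubic_majorant B n - cubic_majorant B' n"
proof -
  have nn': "0 \<le> B' n" for n using bound'[of n] norm_ge_zero order_trans by blast
  have le: "B' n \<le> B n" for n using diff[of n] norm_ge_zero[of "b n - b' n"] by linarith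
  have nn: "0 \<le> B n" for n using nn' le order_trans by blast
  have B': "B' summable_on UNIV"
    by (rule summable_on_comparison_test[OF B]) (use nn' le in auto)
  note s = cubic_conv_summable[OF bound B] cubic_conv_summable[OF bound' B']
    triple_product_summable[OF nn B] triple_product_summable[OF nn' B']
  have *: "cmod (b x * cnj (b y) * b z - b' x * cnj (b' y) * b' z)
      \<le> B x * B y * B z - B' x * B' y * B' z" for x y z
  proof -
    have "b x * cnj (b y) * b z - b' x * cnj (b' y) * b' z
      = (b x - b' x) * cnj (b y) * b z + b' x * cnj (b y - b' y) * b z + b' x * cnj (b' y) * (b z - b' z)"
      by (simp add: algebra_simps)
    also have "cmod \<dots> \<le> (B x - B' x) * B y * B z + B' x * (B y - B' y) * B z + B' x * B' y * (B z - B' z)"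
    proof -
      have "cmod ((b x - b' x) * cnj (b y) * b z) \<le> (B x - B' x) * B y * B z"
        unfolding norm_mult complex_mod_cnj using bound diff nn le by (intro mult_mono) auto
      moreover have "cmod (b' x * cnj (b y - b' y) * b z) \<le> B' x * (B y - B' y) * B z"
        unfolding norm_mult complex_mod_cnj using bound bound' diff nn nn' le by (intro mult_mono) auto
      moreover have "cmod (b' x * cnj (b' y) * (b z - b' z)) \<le> B' x * B' y * (B z - B' z)"
        unfolding norm_mult complex_mod_cnj using bound' diff nn' le by (intro mult_mono) auto
      ultimately show ?thesis
        by (meson norm_triangle_mono)
    qed
    finally show ?thesis by (simp add: algebra_simps)
  qed
  show ?thesis
    unfolding cubic_conv_eq cubic_majorant_def
    by (rule norm_infsum_le[OF has_sum_diff[OF has_sum_infsum has_sum_infsum]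
          has_sum_diff[OF has_sum_infsum has_sum_infsum]])
      (use * in \<open>auto intro!: s\<close>)
qed

lemma cubic_conv_tendsto:
  assumes "\<And>n. ((\<lambda>y. b y n) \<longlongrightarrow> b' n) G"
    and bound: "\<And>n y. y \<in> Y \<Longrightarrow> cmod (b y n) \<le> B n" and B: "B summable_on UNIV"
    and ev: "\<forall>\<^sub>F y in G. y \<in> Y"
  shows "((\<lambda>y. cubic_conv (b y) n) \<longlongrightarrow> cubic_conv b' n) G"
proof (cases "G = bot")
  case False
  with ev obtain y where "y \<in> Y" using eventually_happens by blast
  \<comment> \<open>The sign of \<open>B\<close> is read off at one point of \<open>Y\<close>, which
    exists because \<open>G\<close> is nontrivial here.\<close>
  then have nn: "0 \<le> B n" for n using bound[of y n] norm_ge_zero order_trans by blast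
  show ?thesis
    unfolding cubic_conv_eq
    by (rule tendsto_infsum_dominated[OF _ cubic_conv_summand_bound[OF bound]
        triple_product_summable[OF nn B] ev False])
      (auto intro!: tendsto_intros assms split: prod.splits)
qed simp

subsection \<open>Picard iteration with majorants\<close>

definition duhamel ::
  "(int ^ 'k::finite \<Rightarrow> real) \<Rightarrow> real \<Rightarrow> (int ^ 'k \<Rightarrow> complex) \<Rightarrow>
   (real \<Rightarrow> int ^ 'k \<Rightarrow> complex) \<Rightarrow> real \<Rightarrow> int ^ 'k \<Rightarrow> complex" where
  "duhamel q l a b s n = exp (- \<i> * of_real (q n * s)) * a n
     + \<i> * of_real l * integral {0..s} (\<lambda>r. exp (- \<i> * of_real (q n * (s - r))) * cubic_conv (b r) n)"

text \<open>Continuity is asked of each coefficient separately. Together with a summable bound that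
  does not depend on time, this upgrades to continuity in l1 by dominated convergence.\<close>

definition majorized_on :: "real \<Rightarrow> (real \<Rightarrow> 'i \<Rightarrow> complex) \<Rightarrow> ('i \<Rightarrow> real) \<Rightarrow> bool" where
  "majorized_on T b B \<longleftrightarrow> (\<forall>n. continuous_on {0..T} (\<lambda>s. b s n)) \<and> (\<forall>s\<in>{0..T}. \<forall>n. cmod (b s n) \<le> B n)"

lemma continuous_on_cubic_conv:
  assumes "majorized_on T b B" and B: "B summable_on UNIV"
  shows "continuous_on {0..T} (\<lambda>s. cubic_conv (b s) n)"
  unfolding continuous_on_def
proof
  fix s assume "s \<in> {0..T}"
  with assms show "((\<lambda>s. cubic_conv (b s) n) \<longlongrightarrow> cubic_conv (b s) n) (at s within {0..T})"
    by (intro cubic_conv_tendsto[where Y = "{0..T}", OF _ _ B])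
      (auto simp: majorized_on_def continuous_on_def eventually_at_filter)
qed

lemma continuous_on_duhamel:
  assumes "majorized_on T b B" and B: "B summable_on UNIV"
  shows "continuous_on {0..T} (\<lambda>s. duhamel q l a b s n)"
proof -
  \<comment> \<open>Pulling out the phase in \<open>s\<close> leaves an integrand independent of the
    upper limit, so the integral is an ordinary primitive.\<close>
  have split: "exp (- \<i> * of_real (q n * (s - r))) * cubic_conv (b r) n
      = exp (- \<i> * of_real (q n * s)) * (exp (\<i> * of_real (q n * r)) * cubic_conv (b r) n)" for s r
    by (simp add: exp_add[symmetric] algebra_simps)
  have "(\<lambda>r. exp (\<i> * of_real (q n * r)) * cubic_conv (b r) n) integrable_on {0..T}"
    by (intro integrable_continuous_real continuous_intros continuous_on_cubic_conv[OF assms])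
  then have "continuous_on {0..T} (\<lambda>s. integral {0..s} (\<lambda>r. exp (\<i> * of_real (q n * r)) * cubic_conv (b r) n))"
    by (rule indefinite_integral_continuous_1)
  then show ?thesis
    unfolding duhamel_def split integral_mult_right by (intro continuous_intros)
qed

text \<open>The free terms cancel and the phases have modulus one, so only the cubic difference over
  a time at most \<open>T\<close> remains. The bound is shaped like the increment of
  \<open>maj\<close> in the iteration below.\<close>

lemma norm_duhamel_diff_le:
  assumes b: "majorized_on T b B" and B: "B summable_on UNIV"
    and b': "majorized_on T b' B'" and B': "B' summable_on UNIV"
    and diff: "\<And>s n. s \<in> {0..T} \<Longrightarrow> cmod (b s n - b' s n) \<le> B n - B' n"
    and s: "s \<in> {0..T}" and l: "0 \<le> l"
  shows "cmod (duhamel q l a b s n - duhamel q l a b' s n)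
    \<le> l * T * (cubic_majorant B n - cubic_majorant B' n)"
proof -
  let ?e = "\<lambda>r. exp (- \<i> * of_real (q n * (s - r)))"
  have cont: "continuous_on {0..s} (\<lambda>r. cubic_conv (b r) n)" "continuous_on {0..s} (\<lambda>r. cubic_conv (b' r) n)"
    using s by (auto intro: continuous_on_subset[OF continuous_on_cubic_conv[OF b B]]
        continuous_on_subset[OF continuous_on_cubic_conv[OF b' B']])
  have bound: "cmod (cubic_conv (b r) n - cubic_conv (b' r) n) \<le> cubic_majorant B n - cubic_majorant B' n"
    if "r \<in> {0..T}" for r
    using that b b' diff by (intro norm_cubic_conv_diff_le[OF _ B]) (auto simp: majorized_on_def)
  then have nn: "0 \<le> cubic_majorant B n - cubic_majorant B' n"
    using s norm_ge_zero order_trans by blast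
  have "integral {0..s} (\<lambda>r. ?e r * cubic_conv (b r) n) - integral {0..s} (\<lambda>r. ?e r * cubic_conv (b' r) n)
      = integral {0..s} (\<lambda>r. ?e r * (cubic_conv (b r) n - cubic_conv (b' r) n))"
    unfolding right_diff_distrib
    by (intro integral_diff[symmetric] integrable_continuous_real continuous_intros cont)
  also have "cmod \<dots> \<le> (cubic_majorant B n - cubic_majorant B' n) * (s - 0)"
    using s bound by (intro integral_bound continuous_intros cont) (auto simp: norm_mult)
  also have "\<dots> \<le> (cubic_majorant B n - cubic_majorant B' n) * T"
    using s nn by (intro mult_left_mono) auto
  finally have *: "cmod (integral {0..s} (\<lambda>r. ?e r * cubic_conv (b r) n)
      - integral {0..s} (\<lambda>r. ?e r * cubic_conv (b' r) n))
    \<le> (cubic_majorant B n - cubic_majorant B' n) * T" .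
  have "duhamel q l a b s n - duhamel q l a b' s n
      = \<i> * of_real l * (integral {0..s} (\<lambda>r. ?e r * cubic_conv (b r) n)
      - integral {0..s} (\<lambda>r. ?e r * cubic_conv (b' r) n))"
    by (simp add: duhamel_def right_diff_distrib)
  then have "cmod (duhamel q l a b s n - duhamel q l a b' s n)
      = l * cmod (integral {0..s} (\<lambda>r. ?e r * cubic_conv (b r) n)
      - integral {0..s} (\<lambda>r. ?e r * cubic_conv (b' r) n))"
    using l by (simp only: norm_mult norm_of_real norm_ii abs_of_nonneg mult_1_left)
  also have "\<dots> \<le> l * ((cubic_majorant B n - cubic_majorant B' n) * T)"
    using * l by (rule mult_left_mono)
  finally show ?thesis by (simp only: mult.assoc mult.commute[of T])
qed

text \<open>Dominated convergence twice: over the triples inside the convolution, then in the time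
  integral with the constant bound \<open>cubic_majorant B n\<close>.\<close>

lemma duhamel_tendsto:
  assumes b: "\<And>k. majorized_on T (b k) B" and B: "B summable_on UNIV"
    and lim: "\<And>s n. s \<in> {0..T} \<Longrightarrow> (\<lambda>k. b k s n) \<longlonglongrightarrow> b' s n"
    and s: "s \<in> {0..T}"
  shows "(\<lambda>k. duhamel q l a (b k) s n) \<longlonglongrightarrow> duhamel q l a b' s n"
proof -
  let ?e = "\<lambda>r. exp (- \<i> * of_real (q n * (s - r)))"
  have bound: "cmod (cubic_conv (b k r) n) \<le> cubic_majorant B n" if "r \<in> {0..s}" for k r
    using that s b by (intro norm_cubic_conv_le[OF _ B]) (auto simp: majorized_on_def)
  have cont: "continuous_on {0..s} (\<lambda>r. cubic_conv (b k r) n)" for k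
    using s by (intro continuous_on_subset[OF continuous_on_cubic_conv[OF b B]]) auto
  have conv: "(\<lambda>k. cubic_conv (b k r) n) \<longlonglongrightarrow> cubic_conv (b' r) n" if "r \<in> {0..s}" for r
    using that s b lim
    by (intro cubic_conv_tendsto[where Y = UNIV, OF _ _ B]) (auto simp: majorized_on_def)
  have "(\<lambda>k. integral {0..s} (\<lambda>r. ?e r * cubic_conv (b k r) n))
      \<longlonglongrightarrow> integral {0..s} (\<lambda>r. ?e r * cubic_conv (b' r) n)"
    by (rule dominated_convergence(2)[where h = "\<lambda>_. cubic_majorant B n"])
      (use bound conv cont in \<open>auto intro!: integrable_continuous_real continuous_intros simp: norm_mult\<close>)
  then show ?thesis
    unfolding duhamel_def by (intro tendsto_intros)
qed

lemma cubic_conv_0: "cubic_conv (\<lambda>_. 0) n = 0"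
  by (simp add: cubic_conv_def case_prod_unfold)

lemma cubic_majorant_0: "cubic_majorant (\<lambda>_. 0) n = 0"
  by (simp add: cubic_majorant_def case_prod_unfold)

text \<open>
  Cauchy's majorant method: \<open>maj\<close> is the Picard iteration in which coefficients and phases are
  replaced by their moduli, and \<open>\<bar>iter (k + 1) - iter k\<bar> \<le> maj (k + 1) - maj k\<close> coefficientwise. So
  convergence of \<open>iter\<close> follows from monotonicity and boundedness of \<open>maj\<close>; no contraction in
  \<open>\<ell>\<^sup>1\<close> is needed.
\<close>

locale small_cubic_duhamel =
  fixes q :: "int ^ 'k::finite \<Rightarrow> real" and l T K :: real and a :: "int ^ 'k \<Rightarrow> complex"
  assumes a_summable: "(\<lambda>n. cmod (a n)) summable_on UNIV"
    and a_le: "(\<Sum>\<^sub>\<infinity>n. cmod (a n)) \<le> K"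
    and l_nonneg: "0 \<le> l" and T_nonneg: "0 \<le> T"
    and small: "8 * (l * T) * K\<^sup>2 \<le> 1"
begin

primrec maj :: "nat \<Rightarrow> int ^ 'k \<Rightarrow> real" where
  "maj 0 = (\<lambda>n. 0)"
| "maj (Suc k) = (\<lambda>n. cmod (a n) + l * T * cubic_majorant (maj k) n)"

primrec iter :: "nat \<Rightarrow> real \<Rightarrow> int ^ 'k \<Rightarrow> complex" where
  "iter 0 = (\<lambda>s n. 0)"
| "iter (Suc k) = duhamel q l a (iter k)"

lemma lT_nonneg: "0 \<le> l * T"
  using l_nonneg T_nonneg by simp

lemma K_nonneg: "0 \<le> K"
  using a_le infsum_nonneg[of UNIV "\<lambda>n. cmod (a n)"] by simp

lemma maj_nonneg: "0 \<le> maj k n"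
  by (induction k arbitrary: n) (simp_all add: cubic_majorant_nonneg lT_nonneg)

text \<open>A sum at most \<open>2 * K\<close> has cube at most \<open>8 * K ^ 3\<close>, and
  \<open>small\<close> turns \<open>8 * (l * T) * K ^ 3\<close> into at most \<open>K\<close>; this
  closes the induction. The finer first bound is carried along because it later measures the
  distance to the linear evolution.\<close>

lemma maj_has_sum:
  "\<exists>s. (maj k has_sum s) UNIV \<and> s \<le> (\<Sum>\<^sub>\<infinity>n. cmod (a n)) + 8 * (l * T) * K ^ 3 \<and> s \<le> 2 * K"
proof (induction k)
  case 0
  have "0 \<le> (\<Sum>\<^sub>\<infinity>n. cmod (a n))" by (rule infsum_nonneg) simp
  then show ?case using K_nonneg lT_nonneg by (intro exI[of _ 0]) auto
next
  case (Suc k)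
  then obtain s where s: "(maj k has_sum s) UNIV" "s \<le> 2 * K" by blast
  have "0 \<le> s" using s(1) maj_nonneg by (rule has_sum_nonneg)
  then have "l * T * s ^ 3 \<le> l * T * (2 * K) ^ 3"
    using s(2) lT_nonneg by (intro mult_left_mono power_mono) auto
  then have le: "l * T * s ^ 3 \<le> 8 * (l * T) * K ^ 3" by (simp add: power_mult_distrib)
  have "8 * (l * T) * K ^ 3 = 8 * (l * T) * K\<^sup>2 * K" by (simp add: power3_eq_cube power2_eq_square)
  also have "\<dots> \<le> 1 * K" using small K_nonneg by (rule mult_right_mono)
  finally have "8 * (l * T) * K ^ 3 \<le> K" by simp
  moreover have "(maj (Suc k) has_sum (\<Sum>\<^sub>\<infinity>n. cmod (a n)) + l * T * s ^ 3) UNIV"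
    unfolding maj.simps
    by (intro has_sum_add has_sum_infsum a_summable has_sum_cmult_right
        cubic_majorant_has_sum maj_nonneg s)
  ultimately show ?case using le a_le by (intro exI conjI) auto
qed

lemma maj_summable: "maj k summable_on UNIV"
  using maj_has_sum has_sum_imp_summable by blast

lemma sum_maj_le:
  assumes "finite F"
  shows "sum (maj k) F \<le> (\<Sum>\<^sub>\<infinity>n. cmod (a n)) + 8 * (l * T) * K ^ 3"
proof -
  obtain s where s: "(maj k has_sum s) UNIV" "s \<le> (\<Sum>\<^sub>\<infinity>n. cmod (a n)) + 8 * (l * T) * K ^ 3"
    using maj_has_sum by blast
  have "sum (maj k) F \<le> s"
    by (rule finite_sum_le_has_sum[OF s(1) assms]) (simp_all add: maj_nonneg)
  with s(2) show ?thesis by linarith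
qed

lemma maj_Suc_ge: "maj k n \<le> maj (Suc k) n"
proof (induction k arbitrary: n)
  case 0
  show ?case using maj_nonneg[of 1 n] by simp
next
  case (Suc k)
  then have "cubic_majorant (maj k) n \<le> cubic_majorant (maj (Suc k)) n"
    by (intro cubic_majorant_mono maj_nonneg maj_summable)
  with lT_nonneg show ?case
    by (subst (2) maj.simps) (simp add: mult_left_mono)
qed

section \<open>The limit of the increasing majorants\<close>

definition maj_lim :: "int ^ 'k \<Rightarrow> real" where
  "maj_lim n = (SUP k. maj k n)"

lemma bdd_above_maj: "bdd_above (range (\<lambda>k. maj k n))"
  using sum_maj_le[of "{n}"] by (intro bdd_aboveI2) simp

lemma maj_tendsto: "(\<lambda>k. maj k n) \<longlonglongrightarrow> maj_lim n"
  unfolding maj_lim_def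
  by (intro LIMSEQ_incseq_SUP bdd_above_maj incseq_SucI maj_Suc_ge)

lemma maj_le_lim: "maj k n \<le> maj_lim n"
  unfolding maj_lim_def by (rule cSUP_upper[OF UNIV_I bdd_above_maj])

lemma sum_maj_lim_le:
  assumes "finite F"
  shows "sum maj_lim F \<le> (\<Sum>\<^sub>\<infinity>n. cmod (a n)) + 8 * (l * T) * K ^ 3"
proof (rule LIMSEQ_le_const2)
  show "(\<lambda>k. sum (maj k) F) \<longlonglongrightarrow> sum maj_lim F"
    by (intro tendsto_sum maj_tendsto)
qed (use sum_maj_le[OF assms] in blast)

lemma maj_lim_nonneg: "0 \<le> maj_lim n"
  using maj_le_lim[of 0 n] by simp

lemma maj_lim_summable: "maj_lim summable_on UNIV"
  using sum_maj_lim_le by (intro nonneg_bdd_above_summable_on bdd_aboveI2 maj_lim_nonneg) auto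

lemma infsum_maj_lim_le: "(\<Sum>\<^sub>\<infinity>n. maj_lim n) \<le> (\<Sum>\<^sub>\<infinity>n. cmod (a n)) + 8 * (l * T) * K ^ 3"
  using sum_maj_lim_le by (intro infsum_le_finite_sums maj_lim_summable) auto

text \<open>The three claims need each other: the next increment is estimated from the majorization
  of two consecutive iterates and their difference, and adding it to the current bound majorizes the
  next iterate.\<close>

lemma iter_majorized:
  "majorized_on T (iter k) (maj k) \<and> majorized_on T (iter (Suc k)) (maj (Suc k)) \<and>
   (\<forall>s\<in>{0..T}. \<forall>n. cmod (iter (Suc k) s n - iter k s n) \<le> maj (Suc k) n - maj k n)"
proof (induction k)
  case 0
  have zero: "majorized_on T (iter 0) (maj 0)" by (simp add: majorized_on_def)
  \<comment> \<open>The first iterate is the free evolution, whose coefficients keep the modulus of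
    \<open>a n\<close>.\<close>
  have one: "cmod (iter (Suc 0) s n) = maj (Suc 0) n" for s n
    by (simp add: duhamel_def cubic_conv_0 cubic_majorant_0 norm_mult)
  have "continuous_on {0..T} (\<lambda>s. iter (Suc 0) s n)" for n
    using continuous_on_duhamel[OF zero maj_summable] by simp
  with one have "majorized_on T (iter (Suc 0)) (maj (Suc 0))"
    unfolding majorized_on_def by (auto simp del: iter.simps(2) maj.simps(2))
  with zero one show ?case
    by (auto simp del: iter.simps(2) maj.simps(2))
next
  case (Suc k)
  then have m: "majorized_on T (iter k) (maj k)" "majorized_on T (iter (Suc k)) (maj (Suc k))"
    and d: "\<And>s n. s \<in> {0..T} \<Longrightarrow> cmod (iter (Suc k) s n - iter k s n) \<le> maj (Suc k) n - maj k n"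
    by blast+
  have step: "cmod (iter (Suc (Suc k)) s n - iter (Suc k) s n) \<le> maj (Suc (Suc k)) n - maj (Suc k) n"
    if "s \<in> {0..T}" for s n
  proof -
    have "iter (Suc (Suc k)) s n - iter (Suc k) s n
        = duhamel q l a (iter (Suc k)) s n - duhamel q l a (iter k) s n"
      by (simp only: iter.simps)
    moreover have "maj (Suc (Suc k)) n - maj (Suc k) n
        = l * T * (cubic_majorant (maj (Suc k)) n - cubic_majorant (maj k) n)"
      by (simp add: right_diff_distrib)
    ultimately show ?thesis
      using norm_duhamel_diff_le[OF m(2) maj_summable m(1) maj_summable d that l_nonneg, of q a n]
      by (simp only:)
  qed
  have "cmod (iter (Suc (Suc k)) s n) \<le> maj (Suc (Suc k)) n" if "s \<in> {0..T}" for s n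
  proof -
    have "cmod (iter (Suc k) s n) \<le> maj (Suc k) n"
      using m(2) that unfolding majorized_on_def by blast
    with step[OF that, of n] norm_triangle_sub[of "iter (Suc (Suc k)) s n" "iter (Suc k) s n"]
    show ?thesis by linarith
  qed
  moreover have "continuous_on {0..T} (\<lambda>s. iter (Suc (Suc k)) s n)" for n
    using continuous_on_duhamel[OF m(2) maj_summable] by (subst iter.simps)
  ultimately have "majorized_on T (iter (Suc (Suc k))) (maj (Suc (Suc k)))"
    unfolding majorized_on_def by blast
  with m(2) step show ?case by blast
qed

lemma iter_diff_le:
  assumes "s \<in> {0..T}" and "j \<le> k"
  shows "cmod (iter k s n - iter j s n) \<le> maj k n - maj j n"
  using assms(2)
proof (induction k rule: dec_induct)
  case (step k)
  have "cmod (iter (Suc k) s n - iter k s n) \<le> maj (Suc k) n - maj k n"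
    using iter_majorized assms(1) by blast
  with step.IH norm_triangle_ineq[of "iter (Suc k) s n - iter k s n" "iter k s n - iter j s n"]
  show ?case by (simp del: iter.simps maj.simps)
qed simp

section \<open>The solution as coefficientwise limit of the iterates\<close>

definition sol :: "real \<Rightarrow> int ^ 'k \<Rightarrow> complex" where
  "sol s n = lim (\<lambda>k. iter k s n)"

lemma iter_tendsto:
  assumes "s \<in> {0..T}"
  shows "(\<lambda>k. iter k s n) \<longlonglongrightarrow> sol s n"
proof -
  have "Cauchy (\<lambda>k. iter k s n)"
  proof (rule metric_CauchyI)
    fix e :: real assume "0 < e"
    moreover have "Cauchy (\<lambda>k. maj k n)" using maj_tendsto LIMSEQ_imp_Cauchy by blast
    ultimately obtain N where N: "\<And>j k. N \<le> j \<Longrightarrow> N \<le> k \<Longrightarrow> dist (maj j n) (maj k n) < e"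
      unfolding Cauchy_def by blast
    have "dist (iter j s n) (iter k s n) < e" if "N \<le> j" "N \<le> k" for j k
    proof (cases "j \<le> k")
      case True
      then show ?thesis
        using iter_diff_le[OF assms True, of n] N[OF that] by (auto simp: dist_norm norm_minus_commute)
    next
      case False
      then show ?thesis
        using iter_diff_le[OF assms, of k j n] N[OF that] by (auto simp: dist_norm)
    qed
    then show "\<exists>N. \<forall>j\<ge>N. \<forall>k\<ge>N. dist (iter j s n) (iter k s n) < e" by blast
  qed
  then show ?thesis
    unfolding sol_def by (simp add: Cauchy_convergent_iff convergent_LIMSEQ_iff)
qed

text \<open>Used at three places: \<open>j = 0\<close> majorizes the solution, \<open>j = 1\<close>
  compares it with the free evolution, and general \<open>j\<close> gives convergence uniform in
  time.\<close>

lemma sol_diff_le: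
  assumes "s \<in> {0..T}"
  shows "cmod (sol s n - iter j s n) \<le> maj_lim n - maj j n"
proof (rule LIMSEQ_le)
  show "(\<lambda>k. cmod (iter k s n - iter j s n)) \<longlonglongrightarrow> cmod (sol s n - iter j s n)"
    by (intro tendsto_intros iter_tendsto assms)
  show "(\<lambda>k. maj k n - maj j n) \<longlonglongrightarrow> maj_lim n - maj j n"
    by (intro tendsto_intros maj_tendsto)
qed (use iter_diff_le[OF assms] in blast)

lemma sol_majorized: "majorized_on T sol maj_lim"
proof -
  have "uniform_limit {0..T} (\<lambda>k s. iter k s n) (\<lambda>s. sol s n) sequentially" for n
  proof (rule uniform_limitI)
    fix e :: real assume "0 < e"
    have "\<forall>\<^sub>F k in sequentially. dist (maj k n) (maj_lim n) < e"
      using maj_tendsto \<open>0 < e\<close> by (rule tendstoD)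
    then show "\<forall>\<^sub>F k in sequentially. \<forall>s\<in>{0..T}. dist (iter k s n) (sol s n) < e"
    proof (rule eventually_mono, intro ballI)
      fix k s assume k: "dist (maj k n) (maj_lim n) < e" and s: "s \<in> {0..T}"
      show "dist (iter k s n) (sol s n) < e"
        using sol_diff_le[OF s, of n k] k by (simp add: dist_norm norm_minus_commute)
    qed
  qed
  then have "continuous_on {0..T} (\<lambda>s. sol s n)" for n
    by (rule uniform_limit_theorem[rotated])
      (use iter_majorized in \<open>auto simp: majorized_on_def\<close>)
  moreover have "cmod (sol s n) \<le> maj_lim n" if "s \<in> {0..T}" for s n
    using sol_diff_le[OF that, of n 0] by simp
  ultimately show ?thesis by (auto simp: majorized_on_def)
qed

lemma sol_fixed_point:
  assumes "s \<in> {0..T}"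
  shows "sol s n = duhamel q l a sol s n"
proof (rule LIMSEQ_unique)
  show "(\<lambda>k. iter (Suc k) s n) \<longlonglongrightarrow> sol s n"
    by (rule LIMSEQ_Suc[OF iter_tendsto[OF assms]])
  have "majorized_on T (iter k) maj_lim" for k
    using iter_majorized[of k] maj_le_lim[of k] order_trans unfolding majorized_on_def by blast
  then have "(\<lambda>k. duhamel q l a (iter k) s n) \<longlonglongrightarrow> duhamel q l a sol s n"
    by (rule duhamel_tendsto[OF _ maj_lim_summable iter_tendsto assms])
  then show "(\<lambda>k. iter (Suc k) s n) \<longlonglongrightarrow> duhamel q l a sol s n" by simp
qed

text \<open>Each coefficient of the difference tends to 0 and is dominated by twice the summable
  \<open>maj_lim\<close>.\<close>

lemma sol_l1_continuous: "l1_continuous_on T sol"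
  unfolding l1_continuous_on_def
proof (intro conjI ballI)
  fix s assume s: "s \<in> {0..T}"
  have le: "cmod (sol r n) \<le> maj_lim n" if "r \<in> {0..T}" for r n
    using sol_majorized that by (simp add: majorized_on_def)
  show "(\<lambda>n. cmod (sol s n)) summable_on UNIV"
    by (rule Infinite_Sum.abs_summable_on_comparison_test'[OF maj_lim_summable le[OF s]])
  show "((\<lambda>r. \<Sum>\<^sub>\<infinity>n. cmod (sol r n - sol s n)) \<longlongrightarrow> 0) (at s within {0..T})"
  proof (cases "at s within {0..T} = bot")
    case False
    have "((\<lambda>r. \<Sum>\<^sub>\<infinity>n. cmod (sol r n - sol s n)) \<longlongrightarrow> (\<Sum>\<^sub>\<infinity>n::int ^ 'k. 0)) (at s within {0..T})"
    proof (rule tendsto_infsum_dominated[where Y = "{0..T}" and B = "\<lambda>n. maj_lim n + maj_lim n"])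
      fix n
      have "((\<lambda>r. sol r n) \<longlongrightarrow> sol s n) (at s within {0..T})"
        using sol_majorized s by (simp add: majorized_on_def continuous_on_def)
      then show "((\<lambda>r. cmod (sol r n - sol s n)) \<longlongrightarrow> 0) (at s within {0..T})"
        using Lim_null tendsto_norm_zero by blast
      show "norm (cmod (sol r n - sol s n)) \<le> maj_lim n + maj_lim n" if "r \<in> {0..T}" for r
        using norm_triangle_ineq4[of "sol r n" "sol s n"] le[OF that, of n] le[OF s, of n] by simp
    qed (use False summable_on_add[OF maj_lim_summable maj_lim_summable] in \<open>auto simp: eventually_at_filter\<close>)
    then show ?thesis by simp
  qed simp
qed

lemma sol_summable: "(\<lambda>n. cmod (sol T n)) summable_on UNIV"
  using sol_l1_continuous T_nonneg by (simp add: l1_continuous_on_def)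

text \<open>The first majorant is the modulus of \<open>a n\<close>, so the error is dominated by
  \<open>maj_lim n - cmod (a n)\<close>, whose sum is the excess of the majorant over the initial l1
  norm.\<close>

lemma sol_minus_linear_le:
  "(\<Sum>\<^sub>\<infinity>n. cmod (sol T n - exp (- \<i> * of_real (q n * T)) * a n)) \<le> 8 * (l * T) * K ^ 3"
  "(\<lambda>n. cmod (sol T n - exp (- \<i> * of_real (q n * T)) * a n)) summable_on UNIV"
proof -
  have le: "cmod (sol T n - exp (- \<i> * of_real (q n * T)) * a n) \<le> maj_lim n - cmod (a n)" for n
    using sol_diff_le[of T n "Suc 0"] T_nonneg
    by (simp add: duhamel_def cubic_conv_0 cubic_majorant_0)
  have sum: "((\<lambda>n. maj_lim n - cmod (a n)) has_sum (\<Sum>\<^sub>\<infinity>n. maj_lim n) - (\<Sum>\<^sub>\<infinity>n. cmod (a n))) UNIV"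
    by (intro has_sum_diff has_sum_infsum maj_lim_summable a_summable)
  show s: "(\<lambda>n. cmod (sol T n - exp (- \<i> * of_real (q n * T)) * a n)) summable_on UNIV"
    by (rule Infinite_Sum.abs_summable_on_comparison_test'[OF has_sum_imp_summable[OF sum] le])
  have "(\<Sum>\<^sub>\<infinity>n. cmod (sol T n - exp (- \<i> * of_real (q n * T)) * a n))
      \<le> (\<Sum>\<^sub>\<infinity>n. maj_lim n) - (\<Sum>\<^sub>\<infinity>n. cmod (a n))"
    by (rule has_sum_mono[OF has_sum_infsum[OF s] sum le])
  with infsum_maj_lim_le show "(\<Sum>\<^sub>\<infinity>n. cmod (sol T n - exp (- \<i> * of_real (q n * T)) * a n))
      \<le> 8 * (l * T) * K ^ 3" by linarith
qed

end

text \<open>Exhibits a concrete solution; by \<open>sup_exceeds_event\<close> it decides whether an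
  outcome belongs to the event.\<close>

lemma nls_solution_near_linear:
  fixes a :: "int ^ 'k::finite \<Rightarrow> complex"
  assumes a: "(\<lambda>n. cmod (a n)) summable_on UNIV" "(\<Sum>\<^sub>\<infinity>n. cmod (a n)) \<le> K"
    and T: "0 \<le> T" and small: "8 * (\<epsilon> powr \<alpha> * T) * K\<^sup>2 \<le> 1"
  obtains C where "nls_solution blk freq \<alpha> \<epsilon> T a C"
    and "(\<lambda>n. cmod (C T n)) summable_on UNIV"
    and "(\<lambda>n. cmod (C T n - exp (- \<i> * of_real (Qform blk freq n * T)) * a n)) summable_on UNIV"
    and "(\<Sum>\<^sub>\<infinity>n. cmod (C T n - exp (- \<i> * of_real (Qform blk freq n * T)) * a n))
      \<le> 8 * (\<epsilon> powr \<alpha> * T) * K ^ 3"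
proof -
  interpret small_cubic_duhamel "Qform blk freq" "\<epsilon> powr \<alpha>" T K a
    by unfold_locales (use assms in auto)
  have "nls_solution blk freq \<alpha> \<epsilon> T a sol"
    unfolding nls_solution_def
    using sol_l1_continuous sol_fixed_point by (simp add: duhamel_def)
  with sol_summable sol_minus_linear_le show ?thesis by (intro that)
qed

subsection \<open>Gaussian tail bounds\<close>

context prob_space
begin

text \<open>Exponential tilting: multiplying the density by \<open>exp (s * x\<^sup>2)\<close>
  gives, up to the factor 1/sqrt(1-s), the normal density of variance 1/(2(1-s)).\<close>

lemma centered_normal_exp_square:
  assumes D: "distributed M lborel Y (normal_density 0 (sqrt (1 / 2)))" and s: "s < 1"
  shows "integrable M (\<lambda>w. exp (s * (Y w)\<^sup>2))"
    and "expectation (\<lambda>w. exp (s * (Y w)\<^sup>2)) = 1 / sqrt (1 - s)"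
proof -
  let ?\<sigma> = "sqrt (1 / (2 * (1 - s)))"
  have \<sigma>: "?\<sigma>\<^sup>2 = 1 / (2 * (1 - s))" using s by simp
  have 1: "normal_density 0 (sqrt (1 / 2)) x = 1 / sqrt pi * exp (- x\<^sup>2)" for x
    by (simp add: normal_density_def)
  have "2 * pi * ?\<sigma>\<^sup>2 = pi / (1 - s)" "- (x - 0)\<^sup>2 / (2 * ?\<sigma>\<^sup>2) = s * x\<^sup>2 - x\<^sup>2" for x
    unfolding \<sigma> using s by (simp_all add: field_simps)
  then have 2: "normal_density 0 ?\<sigma> x = sqrt (1 - s) / sqrt pi * exp (s * x\<^sup>2 - x\<^sup>2)" for x
    unfolding normal_density_def by (simp add: real_sqrt_divide)
  have eq: "normal_density 0 (sqrt (1 / 2)) x * exp (s * x\<^sup>2) = 1 / sqrt (1 - s) * normal_density 0 ?\<sigma> x" for x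
    unfolding 1 2 using s by (simp add: exp_diff exp_minus field_simps)
  have meas: "(\<lambda>x. exp (s * x\<^sup>2)) \<in> borel_measurable lborel" by measurable
  have "0 < ?\<sigma>" using s by simp
  note int = integrable_normal_density[OF this, of 0] integral_normal_density[OF this, of 0]
  from int(1) have "integrable lborel (\<lambda>x. normal_density 0 (sqrt (1 / 2)) x * exp (s * x\<^sup>2))"
    unfolding eq by (rule integrable_mult_right)
  then show "integrable M (\<lambda>w. exp (s * (Y w)\<^sup>2))"
    by (rule distributed_integrable[THEN iffD1, OF D meas, rotated]) simp
  show "expectation (\<lambda>w. exp (s * (Y w)\<^sup>2)) = 1 / sqrt (1 - s)"
    by (subst distributed_integral[OF D meas, symmetric])
      (use int(2) in \<open>simp_all add: eq\<close>)
qed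

text \<open>The squared modulus is a sum of two independent squares, so two factors 1/sqrt(1-s)
  multiply.\<close>

lemma std_complex_gaussian_exp_square:
  assumes X: "std_complex_gaussian X" and s: "s < 1"
  shows "integrable M (\<lambda>w. exp (s * (cmod (X w))\<^sup>2))"
    and "expectation (\<lambda>w. exp (s * (cmod (X w))\<^sup>2)) = 1 / (1 - s)"
proof -
  have D: "distributed M lborel (\<lambda>w. Re (X w)) (normal_density 0 (sqrt (1 / 2)))"
    "distributed M lborel (\<lambda>w. Im (X w)) (normal_density 0 (sqrt (1 / 2)))"
    and indep: "indep_var borel (\<lambda>w. Re (X w)) borel (\<lambda>w. Im (X w))"
    using X by (simp_all add: std_complex_gaussian_def)
  have split: "exp (s * (cmod (X w))\<^sup>2) = exp (s * (Re (X w))\<^sup>2) * exp (s * (Im (X w))\<^sup>2)" for w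
    by (simp add: cmod_power2 exp_add[symmetric] distrib_left)
  have indep': "indep_var borel (\<lambda>w. exp (s * (Re (X w))\<^sup>2)) borel (\<lambda>w. exp (s * (Im (X w))\<^sup>2))"
    using indep_var_compose[OF indep, of "\<lambda>x. exp (s * x\<^sup>2)" borel "\<lambda>x. exp (s * x\<^sup>2)" borel]
    by (simp add: o_def)
  note I = indep' centered_normal_exp_square(1)[OF D(1) s] centered_normal_exp_square(1)[OF D(2) s]
  show "integrable M (\<lambda>w. exp (s * (cmod (X w))\<^sup>2))"
    unfolding split by (rule indep_var_integrable[OF I])
  show "expectation (\<lambda>w. exp (s * (cmod (X w))\<^sup>2)) = 1 / (1 - s)"
    unfolding split using s
    by (simp add: indep_var_lebesgue_integral[OF I] centered_normal_exp_square(2)[OF D(1) s]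
        centered_normal_exp_square(2)[OF D(2) s])
qed

text \<open>Convexity, \<open>exp (w a) \<le> 1 + w (exp a - 1)\<close>, turns the factors into \<open>exp (w s / (1 - s))\<close>.\<close>

lemma weighted_square_sum_tail:
  fixes g :: "'i \<Rightarrow> 'a \<Rightarrow> complex"
  assumes F: "finite F" and indep: "indep_vars (\<lambda>_. borel) g F"
    and X: "\<And>n. n \<in> F \<Longrightarrow> std_complex_gaussian (g n)"
    and v: "\<And>n. n \<in> F \<Longrightarrow> 0 \<le> v n" "\<And>n. n \<in> F \<Longrightarrow> v n \<le> 1"
    and s: "0 < s" "s < 1"
  shows "prob {w \<in> space M. R \<le> (\<Sum>n\<in>F. v n * (cmod (g n w))\<^sup>2)} \<le> exp (s / (1 - s) * sum v F) * exp (- (s * R))"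
proof -
  let ?Y = "\<lambda>n w. exp (s * v n * (cmod (g n w))\<^sup>2)"
  have sv: "s * v n < 1" if "n \<in> F" for n
  proof -
    have "s * v n \<le> s * 1" using v(2)[OF that] s(1) by (intro mult_left_mono) auto
    with s(2) show ?thesis by simp
  qed
  have int: "integrable M (?Y n)" if "n \<in> F" for n
    by (rule std_complex_gaussian_exp_square(1)[OF X[OF that] sv[OF that]])
  have le: "expectation (?Y n) \<le> exp (s / (1 - s) * v n)" if "n \<in> F" for n
  proof -
    have 0: "0 < 1 - s * v n" using sv[OF that] by simp
    \<comment> \<open>Replacing \<open>1 - s * v n\<close> by the smaller \<open>1 - s\<close> makes
      the bound linear in \<open>v n\<close>; the product over \<open>F\<close> then depends only on
      \<open>sum v F\<close>.\<close>
    have "s * v n * (1 - s) \<le> s * v n * (1 - s * v n)"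
      using v[OF that] s by (intro mult_left_mono) (auto simp: mult_left_le)
    then have "s * v n / (1 - s * v n) \<le> s * v n / (1 - s)"
      using 0 s by (simp add: divide_simps)
    moreover have "1 / (1 - s * v n) = 1 + s * v n / (1 - s * v n)" using 0 by (simp add: field_simps)
    ultimately have "expectation (?Y n) \<le> 1 + s / (1 - s) * v n"
      using std_complex_gaussian_exp_square(2)[OF X[OF that] sv[OF that]] by simp
    also have "\<dots> \<le> exp (s / (1 - s) * v n)" by (rule exp_ge_add_one_self)
    finally show ?thesis .
  qed
  have indep': "indep_vars (\<lambda>_. borel) ?Y F"
    using indep by (rule indep_vars_compose2) measurable
  have eq: "exp (s * (\<Sum>n\<in>F. v n * (cmod (g n w))\<^sup>2)) = (\<Prod>n\<in>F. ?Y n w)" for w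
    by (simp add: exp_sum[OF F, symmetric] sum_distrib_left mult.assoc)
  have I: "integrable M (\<lambda>w. \<Prod>n\<in>F. ?Y n w)"
    by (rule indep_vars_integrable[OF F indep' int])
  \<comment> \<open>Chernoff bound: Markov's inequality for the exponential of \<open>s\<close>
    times the weighted sum.\<close>
  have "prob {w \<in> space M. R \<le> (\<Sum>n\<in>F. v n * (cmod (g n w))\<^sup>2)}
      = prob {w \<in> space M. exp (s * R) \<le> (\<Prod>n\<in>F. ?Y n w)}"
    unfolding eq[symmetric] using s by simp
  also have "\<dots> \<le> expectation (\<lambda>w. \<Prod>n\<in>F. ?Y n w) / exp (s * R)"
    using I by (rule integral_Markov_inequality_measure[where A = "{}"]) (auto intro!: prod_nonneg)
  also have "expectation (\<lambda>w. \<Prod>n\<in>F. ?Y n w) = (\<Prod>n\<in>F. expectation (?Y n))"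
    by (rule indep_vars_lebesgue_integral[OF F indep' int])
  also have "\<dots> \<le> (\<Prod>n\<in>F. exp (s / (1 - s) * v n))"
    by (intro prod_mono conjI le integral_nonneg) auto
  also have "\<dots> = exp (s / (1 - s) * sum v F)"
    by (simp add: exp_sum[OF F, symmetric] sum_distrib_left)
  finally show ?thesis
    by (simp add: exp_minus divide_inverse divide_right_mono)
qed

text \<open>Finite partial sums are used so that outcomes with divergent l1 norm belong to the
  event; \<open>infsum\<close> would assign them the value 0.\<close>

definition l1_exceeds :: "('i \<Rightarrow> complex) \<Rightarrow> ('i \<Rightarrow> 'a \<Rightarrow> complex) \<Rightarrow> real \<Rightarrow> 'a set" where
  "l1_exceeds c g z = {w \<in> space M. \<exists>F. finite F \<and> z < (\<Sum>n\<in>F. cmod (c n) * cmod (g n w))}"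

text \<open>The terms are nonnegative, so initial segments of an enumeration suffice. This yields
  measurability and an increasing union.\<close>

lemma l1_exceeds_eq_UN:
  fixes g :: "'i::countable \<Rightarrow> 'a \<Rightarrow> complex"
  shows "l1_exceeds c g z =
    (\<Union>k. {w \<in> space M. z < (\<Sum>n\<in>{n. to_nat n < k}. cmod (c n) * cmod (g n w))})"
    (is "_ = (\<Union>k. ?A k)")
    and "finite {n :: 'i. to_nat n < k}"
proof -
  show fin: "finite {n :: 'i. to_nat n < k}" for k
    by (rule inj_on_finite[of to_nat _ "{..<k}"]) (auto simp: inj_on_def)
  show "l1_exceeds c g z = (\<Union>k. ?A k)"
  proof (intro subset_antisym subsetI)
    fix w assume "w \<in> l1_exceeds c g z"
    then obtain F where w: "w \<in> space M" and F: "finite F" "z < (\<Sum>n\<in>F. cmod (c n) * cmod (g n w))"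
      unfolding l1_exceeds_def by blast
    obtain k where "to_nat ` F \<subseteq> {..<k}"
      using finite_nat_iff_bounded[of "to_nat ` F"] F(1) by auto
    then have "(\<Sum>n\<in>F. cmod (c n) * cmod (g n w)) \<le> (\<Sum>n\<in>{n. to_nat n < k}. cmod (c n) * cmod (g n w))"
      by (intro sum_mono2 fin) auto
    with w F(2) have "w \<in> ?A k" by auto
    then show "w \<in> (\<Union>k. ?A k)" by blast
  next
    fix w assume "w \<in> (\<Union>k. ?A k)"
    then show "w \<in> l1_exceeds c g z" unfolding l1_exceeds_def using fin by blast
  qed
qed

lemma l1_exceeds_measurable:
  fixes g :: "'i::countable \<Rightarrow> 'a \<Rightarrow> complex"
  assumes [measurable]: "\<And>n. random_variable borel (g n)"
  shows "l1_exceeds c g z \<in> events"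
  unfolding l1_exceeds_eq_UN by measurable

lemma l1_exceeds_tail:
  fixes g :: "'i::countable \<Rightarrow> 'a \<Rightarrow> complex"
  assumes indep: "indep_vars (\<lambda>_. borel) g UNIV" and X: "\<And>n. std_complex_gaussian (g n)"
    and c: "(\<lambda>n. cmod (c n)) summable_on UNIV" "\<And>n. cmod (c n) \<le> 1"
    and V: "(\<Sum>\<^sub>\<infinity>n. (cmod (c n))\<^sup>2) < V"
  shows "\<exists>B>0. \<forall>z\<ge>0. prob (l1_exceeds c g z) \<le> B * exp (- (z\<^sup>2 / V))"
proof -
  let ?S = "\<Sum>\<^sub>\<infinity>n. (cmod (c n))\<^sup>2" and ?t = "\<Sum>\<^sub>\<infinity>n. cmod (c n)"
  have S0: "0 \<le> ?S" by (rule infsum_nonneg) simp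
  have Ssum: "(\<lambda>n. (cmod (c n))\<^sup>2) summable_on UNIV"
    by (rule summable_on_comparison_test[OF c(1)])
      (use c(2) in \<open>auto simp: power2_eq_square mult_left_le\<close>)
  \<comment> \<open>Half of the gap between \<open>?S\<close> and \<open>V\<close> is granted to the
    l1 tail of \<open>c\<close> off \<open>F0\<close>; then \<open>sum v\<close> stays below the
    midpoint of \<open>?S\<close> and \<open>V\<close>.\<close>
  have "0 < (V - ?S) / 2" using V by simp
  from infsum_finite_approximation[OF c(1) this]
  obtain F0 where F0: "finite F0" "dist (\<Sum>n\<in>F0. cmod (c n)) ?t \<le> (V - ?S) / 2"
    by (metis)
  have F0': "?t - (\<Sum>n\<in>F0. cmod (c n)) \<le> (V - ?S) / 2"
    using abs_le_D2[OF F0(2)[unfolded dist_real_def]] by simp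
  \<comment> \<open>Chosen so that \<open>s * V\<close> is that midpoint: Cauchy-Schwarz gives the
    level \<open>z\<^sup>2 / (s * V)\<close>, and the Chernoff parameter \<open>s\<close> turns it
    into the rate \<open>z\<^sup>2 / V\<close>.\<close>
  define s where "s = (?S + V) / (2 * V)"
  have V0: "0 < V" using S0 V by linarith
  have s: "0 < s" "s < 1" "s * V = (?S + V) / 2"
    using V0 S0 V by (auto simp: s_def field_simps)
  \<comment> \<open>Here \<open>u\<close> is the weight on the squared Gaussians and
    \<open>v\<close> the complementary Cauchy-Schwarz factor, with \<open>u n * v n\<close> equal to
    the square of \<open>cmod (c n)\<close>. Both have finite total mass.\<close>
  define v where "v n = (if n \<in> F0 then (cmod (c n))\<^sup>2 else cmod (c n))" for n
  define u where "u n = (if n \<in> F0 then 1 else cmod (c n))" for n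
  have u: "0 \<le> u n" "u n \<le> 1" for n using c(2) by (auto simp: u_def)
  have v: "0 \<le> v n" for n by (auto simp: v_def)
  have uv: "sqrt (v n) * sqrt (u n) = cmod (c n)" for n
    by (simp add: u_def v_def)
  have off: "(\<Sum>n\<in>G - F0. cmod (c n)) \<le> ?t - (\<Sum>n\<in>F0. cmod (c n))" if "finite G" for G
  proof -
    have "(\<Sum>n\<in>G - F0. cmod (c n)) + (\<Sum>n\<in>F0. cmod (c n)) = (\<Sum>n\<in>(G - F0) \<union> F0. cmod (c n))"
      using that F0 by (subst sum.union_disjoint) auto
    also have "\<dots> \<le> ?t"
      using that F0 c(1) by (intro finite_sum_le_infsum) auto
    finally show ?thesis by simp
  qed
  have split: "sum f G = sum f (G \<inter> F0) + sum f (G - F0)" if "finite G" for f :: "'i \<Rightarrow> real" and G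
    using that by (subst sum.union_disjoint[symmetric]) (auto intro!: sum.cong)
  have sum_v: "sum v G \<le> s * V" if G: "finite G" for G
  proof -
    have "sum v (G \<inter> F0) = (\<Sum>n\<in>G \<inter> F0. (cmod (c n))\<^sup>2)" by (intro sum.cong) (auto simp: v_def)
    also have "\<dots> \<le> ?S" using G Ssum by (intro finite_sum_le_infsum) auto
    finally have 1: "sum v (G \<inter> F0) \<le> ?S" .
    have "sum v (G - F0) = (\<Sum>n\<in>G - F0. cmod (c n))" by (intro sum.cong) (auto simp: v_def)
    with off[OF G] F0' have "sum v (G - F0) \<le> (V - ?S) / 2" by linarith
    with 1 show ?thesis unfolding s(3) split[OF G] by (simp add: field_simps)
  qed
  have sum_u: "sum u G \<le> card F0 + ?t" if G: "finite G" for G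
  proof -
    have "sum u (G \<inter> F0) = card (G \<inter> F0)" by (simp add: u_def)
    also have "\<dots> \<le> card F0" using F0(1) by (simp add: card_mono)
    finally have 1: "sum u (G \<inter> F0) \<le> card F0" by simp
    have "sum u (G - F0) = (\<Sum>n\<in>G - F0. cmod (c n))" by (intro sum.cong) (auto simp: u_def)
    also have "\<dots> \<le> ?t" using off[OF G] sum_nonneg[of F0 "\<lambda>n. cmod (c n)"] by simp
    finally show ?thesis using 1 unfolding split[OF G] by simp
  qed
  \<comment> \<open>Independent of the finite set \<open>G\<close>, so the bound survives the
    passage to the increasing union.\<close>
  define B where "B = exp (s / (1 - s) * (card F0 + ?t))"
  have fin_tail: "prob {w \<in> space M. z < (\<Sum>n\<in>G. cmod (c n) * cmod (g n w))} \<le> B * exp (- (z\<^sup>2 / V))"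
    if G: "finite G" and z: "0 \<le> z" for G z
  proof -
    have [measurable]: "\<And>n. random_variable borel (g n)"
      using X by (simp add: std_complex_gaussian_def)
    have "z\<^sup>2 / (s * V) \<le> (\<Sum>n\<in>G. u n * (cmod (g n w))\<^sup>2)"
      if w: "z < (\<Sum>n\<in>G. cmod (c n) * cmod (g n w))" for w
    proof -
      have "z\<^sup>2 \<le> (\<Sum>n\<in>G. cmod (c n) * cmod (g n w))\<^sup>2"
        using z w by (intro power_mono) auto
      also have "\<dots> = (\<Sum>n\<in>G. sqrt (v n) * (sqrt (u n) * cmod (g n w)))\<^sup>2"
        by (simp add: uv mult.assoc[symmetric])
      also have "\<dots> \<le> (\<Sum>n\<in>G. (sqrt (v n))\<^sup>2) * (\<Sum>n\<in>G. (sqrt (u n) * cmod (g n w))\<^sup>2)"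
        by (rule Cauchy_Schwarz_ineq_sum)
      also have "\<dots> = sum v G * (\<Sum>n\<in>G. u n * (cmod (g n w))\<^sup>2)"
        using u v by (simp add: power_mult_distrib)
      also have "\<dots> \<le> s * V * (\<Sum>n\<in>G. u n * (cmod (g n w))\<^sup>2)"
        using u by (intro mult_right_mono sum_v G sum_nonneg) auto
      finally show ?thesis using s V0 by (simp add: divide_le_eq mult.commute)
    qed
    then have "prob {w \<in> space M. z < (\<Sum>n\<in>G. cmod (c n) * cmod (g n w))}
      \<le> prob {w \<in> space M. z\<^sup>2 / (s * V) \<le> (\<Sum>n\<in>G. u n * (cmod (g n w))\<^sup>2)}"
      by (intro finite_measure_mono) auto
    also have "\<dots> \<le> exp (s / (1 - s) * sum u G) * exp (- (s * (z\<^sup>2 / (s * V))))"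
      by (rule weighted_square_sum_tail[OF G indep_vars_subset[OF indep subset_UNIV] X u s(1,2)])
    also have "\<dots> \<le> B * exp (- (z\<^sup>2 / V))"
    proof (rule mult_mono)
      show "exp (s / (1 - s) * sum u G) \<le> B"
        unfolding B_def using sum_u[OF G] s(1,2) by (simp add: mult_left_mono divide_right_mono)
    qed (use s(1) in \<open>auto simp: B_def\<close>)
    finally show ?thesis .
  qed
  have "prob (l1_exceeds c g z) \<le> B * exp (- (z\<^sup>2 / V))" if z: "0 \<le> z" for z
  proof -
    let ?A = "\<lambda>k. {w \<in> space M. z < (\<Sum>n\<in>{n. to_nat n < k}. cmod (c n) * cmod (g n w))}"
    have [measurable]: "\<And>n. random_variable borel (g n)"
      using X by (simp add: std_complex_gaussian_def)
    have "incseq ?A"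
    proof (rule incseq_SucI, rule subsetI)
      fix k w assume "w \<in> ?A k"
      moreover have "(\<Sum>n\<in>{n. to_nat n < k}. cmod (c n) * cmod (g n w))
          \<le> (\<Sum>n\<in>{n. to_nat n < Suc k}. cmod (c n) * cmod (g n w))"
        by (intro sum_mono2 l1_exceeds_eq_UN(2)) auto
      ultimately show "w \<in> ?A (Suc k)" by auto
    qed
    then have "(\<lambda>k. prob (?A k)) \<longlonglongrightarrow> prob (\<Union>k. ?A k)"
      by (intro finite_Lim_measure_incseq) auto
    then show ?thesis
      unfolding l1_exceeds_eq_UN
      by (rule LIMSEQ_le_const2) (use fin_tail[OF l1_exceeds_eq_UN(2) z] in blast)
  qed
  then show ?thesis by (intro exI[of _ B]) (auto simp: B_def)
qed

text \<open>Rotation invariance: the real part of the product is a combination of the independent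
  real and imaginary parts of \<open>X\<close>, and the variances add up.\<close>

lemma Re_scaled_std_complex_gaussian:
  assumes X: "std_complex_gaussian X" and a: "a \<noteq> 0"
  shows "distributed M lborel (\<lambda>w. Re (a * X w)) (normal_density 0 (cmod a * sqrt (1 / 2)))"
proof -
  have D: "distributed M lborel (\<lambda>w. Re (X w)) (normal_density 0 (sqrt (1 / 2)))"
    "distributed M lborel (\<lambda>w. Im (X w)) (normal_density 0 (sqrt (1 / 2)))"
    and indep: "indep_var borel (\<lambda>w. Re (X w)) borel (\<lambda>w. Im (X w))"
    using X by (simp_all add: std_complex_gaussian_def)
  have re: "distributed M lborel (\<lambda>w. Re a * Re (X w)) (normal_density 0 (\<bar>Re a\<bar> * sqrt (1 / 2)))"
    if "Re a \<noteq> 0"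
    using normal_density_affine[OF D(1) _ that, of 0] by simp
  have im: "distributed M lborel (\<lambda>w. b * Im (X w)) (normal_density 0 (\<bar>b\<bar> * sqrt (1 / 2)))"
    if "b \<noteq> 0" for b
    using normal_density_affine[OF D(2) _ that, of 0] by simp
  \<comment> \<open>A vanishing coefficient would give a degenerate normal law without density, so
    these cases are separate.\<close>
  consider "Im a = 0" "Re a \<noteq> 0" | "Re a = 0" "Im a \<noteq> 0" | "Re a \<noteq> 0" "Im a \<noteq> 0"
    using a by (auto simp: complex_eq_iff)
  then show ?thesis
  proof cases
    case 1
    then show ?thesis using re by (simp add: cmod_def)
  next
    case 2
    then show ?thesis using im[of "- Im a"] by (simp add: cmod_def)
  next
    case 3
    have "indep_var borel (\<lambda>w. Re a * Re (X w)) borel (\<lambda>w. Im a * Im (X w))"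
      using indep_var_compose[OF indep, of "\<lambda>x. Re a * x" borel "\<lambda>x. Im a * x" borel]
      by (simp add: o_def)
    from diff_indep_normal[OF this _ _ re im] 3
    have "distributed M lborel (\<lambda>w. Re a * Re (X w) - Im a * Im (X w))
        (normal_density 0 (sqrt ((\<bar>Re a\<bar> * sqrt (1 / 2))\<^sup>2 + (\<bar>Im a\<bar> * sqrt (1 / 2))\<^sup>2)))"
      by simp
    moreover have "sqrt ((\<bar>Re a\<bar> * sqrt (1 / 2))\<^sup>2 + (\<bar>Im a\<bar> * sqrt (1 / 2))\<^sup>2) = cmod a * sqrt (1 / 2)"
      by (simp add: cmod_def power_mult_distrib real_sqrt_mult[symmetric] add_divide_distrib)
    ultimately show ?thesis by (simp del: real_sqrt_eq_iff)
  qed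
qed

text \<open>On the unit interval right of \<open>z\<close> the density is at least its value at the
  right end. The shift by 1 is harmless at the scale \<epsilon> to the power -1/2.\<close>

lemma normal_tail_ge:
  assumes D: "distributed M lborel Y (normal_density 0 \<sigma>)" and z: "0 \<le> z"
  shows "normal_density 0 \<sigma> (z + 1) \<le> prob {w \<in> space M. z < Y w}"
proof -
  have "ennreal (normal_density 0 \<sigma> (z + 1)) = (\<integral>\<^sup>+x. ennreal (normal_density 0 \<sigma> (z + 1)) * indicator {z<..z + 1} x \<partial>lborel)"
    by (simp add: nn_integral_cmult)
  also have "\<dots> \<le> (\<integral>\<^sup>+x. ennreal (normal_density 0 \<sigma> x) * indicator {z<..} x \<partial>lborel)"
  proof (rule nn_integral_mono)
    fix x
    show "ennreal (normal_density 0 \<sigma> (z + 1)) * indicator {z<..z + 1} x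
        \<le> ennreal (normal_density 0 \<sigma> x) * indicator {z<..} x"
    proof (cases "x \<in> {z<..z + 1}")
      case True
      with z have "x\<^sup>2 \<le> (z + 1)\<^sup>2" by (intro power_mono) auto
      then have "normal_density 0 \<sigma> (z + 1) \<le> normal_density 0 \<sigma> x"
        by (auto simp: normal_density_def intro!: divide_right_mono mult_left_mono)
      with True show ?thesis by (simp add: ennreal_leI)
    qed simp
  qed
  also have "\<dots> = emeasure M (Y -` {z<..} \<inter> space M)"
    by (rule distributed_emeasure[OF D, symmetric]) simp
  also have "Y -` {z<..} \<inter> space M = {w \<in> space M. z < Y w}" by auto
  finally show ?thesis by (simp add: emeasure_eq_measure)
qed

text \<open>The modulus dominates the real part, which is normal with variance \<open>S / 2\<close>.
  Projecting to one real dimension keeps the exponential rate and affects only the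
  prefactor.\<close>

lemma gaussian_sum_tail_ge:
  fixes g :: "'i \<Rightarrow> 'a \<Rightarrow> complex"
  assumes F: "finite F" "F \<noteq> {}" and indep: "indep_vars (\<lambda>_. borel) g F"
    and X: "\<And>n. n \<in> F \<Longrightarrow> std_complex_gaussian (g n)" and a: "\<And>n. n \<in> F \<Longrightarrow> a n \<noteq> 0"
    and z: "0 \<le> z"
  defines "S \<equiv> \<Sum>n\<in>F. (cmod (a n))\<^sup>2"
  shows "1 / sqrt (pi * S) * exp (- ((z + 1)\<^sup>2 / S)) \<le> prob {w \<in> space M. z < cmod (\<Sum>n\<in>F. a n * g n w)}"
proof -
  have [measurable]: "\<And>n. n \<in> F \<Longrightarrow> random_variable borel (g n)"
    using X by (simp add: std_complex_gaussian_def)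
  let ?\<sigma> = "sqrt (\<Sum>n\<in>F. (cmod (a n) * sqrt (1 / 2))\<^sup>2)"
  have S: "?\<sigma>\<^sup>2 = S / 2"
    by (simp add: S_def power_mult_distrib sum_nonneg sum_divide_distrib)
  have "distributed M lborel (\<lambda>w. \<Sum>n\<in>F. Re (a n * g n w)) (normal_density (\<Sum>n\<in>F. 0) ?\<sigma>)"
  proof (rule sum_indep_normal[OF F])
    show "indep_vars (\<lambda>i. borel) (\<lambda>n w. Re (a n * g n w)) F"
      using indep by (rule indep_vars_compose2) measurable
    fix n assume n: "n \<in> F"
    show "0 < cmod (a n) * sqrt (1 / 2)" using a[OF n] by simp
    show "distributed M lborel (\<lambda>w. Re (a n * g n w)) (normal_density 0 (cmod (a n) * sqrt (1 / 2)))"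
      by (rule Re_scaled_std_complex_gaussian[OF X[OF n] a[OF n]])
  qed
  then have D: "distributed M lborel (\<lambda>w. \<Sum>n\<in>F. Re (a n * g n w)) (normal_density 0 ?\<sigma>)" by simp
  have "1 / sqrt (pi * S) * exp (- ((z + 1)\<^sup>2 / S)) = normal_density 0 ?\<sigma> (z + 1)"
    unfolding normal_density_def S by simp
  also have "\<dots> \<le> prob {w \<in> space M. z < (\<Sum>n\<in>F. Re (a n * g n w))}"
    by (rule normal_tail_ge[OF D z])
  also have "\<dots> \<le> prob {w \<in> space M. z < cmod (\<Sum>n\<in>F. a n * g n w)}"
  proof (rule finite_measure_mono)
    show "{w \<in> space M. z < (\<Sum>n\<in>F. Re (a n * g n w))} \<subseteq> {w \<in> space M. z < cmod (\<Sum>n\<in>F. a n * g n w)}"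
      unfolding Re_sum[symmetric] using complex_Re_le_cmod order_less_le_trans by blast
    show "{w \<in> space M. z < cmod (\<Sum>n\<in>F. a n * g n w)} \<in> events" by measurable
  qed
  finally show ?thesis .
qed

end

subsection \<open>Comparison with the linear evolution\<close>

lemma norm_quasi_periodic_le:
  assumes "(\<lambda>n. cmod (b n)) summable_on UNIV"
  shows "cmod (quasi_periodic blk freq b x) \<le> (\<Sum>\<^sub>\<infinity>n. cmod (b n))"
proof -
  have "(\<lambda>n. cmod (b n * exp (\<i> * of_real (theta blk freq n x)))) summable_on UNIV"
    using assms by (simp add: norm_mult)
  from norm_infsum_bound[OF this] show ?thesis
    by (simp add: quasi_periodic_def norm_mult)
qed

context prob_space
begin

lemma not_l1_exceeds:
  assumes w: "w \<in> space M" "w \<notin> l1_exceeds c g z"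
  shows "(\<lambda>n. cmod (c n * g n w)) summable_on UNIV" "(\<Sum>\<^sub>\<infinity>n. cmod (c n * g n w)) \<le> z"
proof -
  have le: "(\<Sum>n\<in>F. cmod (c n * g n w)) \<le> z" if "finite F" for F
    using w that by (auto simp: l1_exceeds_def norm_mult not_less)
  then show s: "(\<lambda>n. cmod (c n * g n w)) summable_on UNIV"
    by (intro nonneg_bdd_above_summable_on bdd_aboveI2[where M = z]) auto
  show "(\<Sum>\<^sub>\<infinity>n. cmod (c n * g n w)) \<le> z"
    using s le by (intro infsum_le_finite_sums) auto
qed

text \<open>If the initial l1 norm is at most \<open>y\<close>, the solution at time
  \<open>T\<close> has l1 norm at most \<open>y\<close> plus the nonlinear error, hence at most
  \<open>z\<close>, and the l1 norm bounds the supremum.\<close>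

lemma event_subset_l1_exceeds:
  assumes E: "sup_exceeds_event M blk freq \<alpha> \<epsilon> T c g z E"
    and T: "0 \<le> T" and small: "8 * (\<epsilon> powr \<alpha> * T) * K\<^sup>2 \<le> 1" and K: "y \<le> K"
    and y: "y + 8 * (\<epsilon> powr \<alpha> * T) * K ^ 3 \<le> z"
  shows "E \<subseteq> l1_exceeds c g y"
proof (rule subsetI, rule ccontr)
  fix w assume "w \<in> E" and no: "w \<notin> l1_exceeds c g y"
  then have w: "w \<in> space M" using E sets.sets_into_space by (auto simp: sup_exceeds_event_def)
  let ?a = "\<lambda>n. c n * g n w"
  note a = not_l1_exceeds[OF w no]
  from a(2) K have aK: "(\<Sum>\<^sub>\<infinity>n. cmod (?a n)) \<le> K" by simp
  obtain C where C: "nls_solution blk freq \<alpha> \<epsilon> T ?a C" "(\<lambda>n. cmod (C T n)) summable_on UNIV"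
    and d: "(\<lambda>n. cmod (C T n - exp (- \<i> * of_real (Qform blk freq n * T)) * ?a n)) summable_on UNIV"
      "(\<Sum>\<^sub>\<infinity>n. cmod (C T n - exp (- \<i> * of_real (Qform blk freq n * T)) * ?a n)) \<le> 8 * (\<epsilon> powr \<alpha> * T) * K ^ 3"
    by (rule nls_solution_near_linear[OF a(1) aK T small])
  have "(\<Sum>\<^sub>\<infinity>n. cmod (C T n)) \<le> (\<Sum>\<^sub>\<infinity>n. cmod (?a n)
      + cmod (C T n - exp (- \<i> * of_real (Qform blk freq n * T)) * ?a n))"
  proof (intro infsum_mono C(2) summable_on_add a(1) d(1))
    fix n
    show "cmod (C T n) \<le> cmod (?a n) + cmod (C T n - exp (- \<i> * of_real (Qform blk freq n * T)) * ?a n)"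
      using norm_triangle_sub[of "C T n" "exp (- \<i> * of_real (Qform blk freq n * T)) * ?a n"]
      by (simp add: norm_mult)
  qed
  also have "\<dots> = (\<Sum>\<^sub>\<infinity>n. cmod (?a n))
      + (\<Sum>\<^sub>\<infinity>n. cmod (C T n - exp (- \<i> * of_real (Qform blk freq n * T)) * ?a n))"
    by (rule infsum_add[OF a(1) d(1)])
  also have "\<dots> \<le> z" using a(2) d(2) y by linarith
  finally have "(SUP x. cmod (quasi_periodic blk freq (C T) x)) \<le> z"
    by (intro cSUP_least[OF UNIV_not_empty] order_trans[OF norm_quasi_periodic_le[OF C(2)]])
  with \<open>w \<in> E\<close> C(1) w E show False by (force simp: sup_exceeds_event_def)
qed

text \<open>Off the two l1 events, the solution at \<open>x = 0\<close> is the Gaussian sum over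
  \<open>F\<close> plus a linear tail of size at most \<open>y\<close> plus the nonlinear error. If
  the sum exceeds \<open>y'\<close>, the supremum exceeds \<open>z\<close>.\<close>

lemma finite_sum_event_subset:
  assumes E: "sup_exceeds_event M blk freq \<alpha> \<epsilon> T c g z E"
    and T: "0 \<le> T" and small: "8 * (\<epsilon> powr \<alpha> * T) * K\<^sup>2 \<le> 1"
    and y: "z + y + 8 * (\<epsilon> powr \<alpha> * T) * K ^ 3 \<le> y'" and F: "finite F"
  shows "{w \<in> space M. y' < cmod (\<Sum>n\<in>F. exp (- \<i> * of_real (Qform blk freq n * T)) * c n * g n w)}
      \<subseteq> E \<union> l1_exceeds (\<lambda>n. if n \<in> F then 0 else c n) g y \<union> l1_exceeds c g K"
proof (rule subsetI, rule ccontr)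
  fix w
  assume "w \<in> {w \<in> space M. y' < cmod (\<Sum>n\<in>F. exp (- \<i> * of_real (Qform blk freq n * T)) * c n * g n w)}"
    and no: "w \<notin> E \<union> l1_exceeds (\<lambda>n. if n \<in> F then 0 else c n) g y \<union> l1_exceeds c g K"
  then have w: "w \<in> space M" and wE: "w \<notin> E"
    and noK: "w \<notin> l1_exceeds c g K" and noy: "w \<notin> l1_exceeds (\<lambda>n. if n \<in> F then 0 else c n) g y"
    and big: "y' < cmod (\<Sum>n\<in>F. exp (- \<i> * of_real (Qform blk freq n * T)) * c n * g n w)"
    by auto
  let ?a = "\<lambda>n. c n * g n w"
  let ?b = "\<lambda>n. exp (- \<i> * of_real (Qform blk freq n * T)) * ?a n"
  note a = not_l1_exceeds[OF w noK] and t = not_l1_exceeds[OF w noy]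
  obtain C where C: "nls_solution blk freq \<alpha> \<epsilon> T ?a C" "(\<lambda>n. cmod (C T n)) summable_on UNIV"
    and d: "(\<lambda>n. cmod (C T n - ?b n)) summable_on UNIV"
      "(\<Sum>\<^sub>\<infinity>n. cmod (C T n - ?b n)) \<le> 8 * (\<epsilon> powr \<alpha> * T) * K ^ 3"
    by (rule nls_solution_near_linear[OF a T small])
  have b: "(\<lambda>n. cmod (?b n)) summable_on UNIV" using a(1) by (simp add: norm_mult)
  let ?r = "\<lambda>n. exp (- \<i> * of_real (Qform blk freq n * T)) * ((if n \<in> F then 0 else c n) * g n w)"
  have norm_r: "cmod (?r n) = cmod ((if n \<in> F then 0 else c n) * g n w)" for n
    by (simp add: norm_mult)
  have r: "(\<lambda>n. cmod (?r n)) summable_on UNIV" "(\<Sum>\<^sub>\<infinity>n. cmod (?r n)) \<le> y"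
    unfolding norm_r using t by blast+
  have "((\<lambda>n. if n \<in> F then ?b n else 0) has_sum sum ?b F) UNIV"
    using F by (intro has_sum_finite_neutralI) auto
  from has_sum_add[OF this has_sum_infsum[OF abs_summable_summable[OF r(1)]]]
  have "(?b has_sum (sum ?b F + infsum ?r UNIV)) UNIV"
    by (rule has_sum_cong[THEN iffD1, rotated]) auto
  from has_sum_add[OF has_sum_infsum[OF abs_summable_summable[OF d(1)]] this]
  have "(C T has_sum (\<Sum>\<^sub>\<infinity>n. C T n - ?b n) + (sum ?b F + infsum ?r UNIV)) UNIV"
    by simp
  then have "quasi_periodic blk freq (C T) 0 = (\<Sum>\<^sub>\<infinity>n. C T n - ?b n) + (sum ?b F + infsum ?r UNIV)"
    by (simp add: quasi_periodic_def theta_def infsumI)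
  moreover have "cmod (\<Sum>\<^sub>\<infinity>n. C T n - ?b n) \<le> 8 * (\<epsilon> powr \<alpha> * T) * K ^ 3"
    using norm_infsum_bound[OF d(1)] d(2) by linarith
  moreover have "cmod (infsum ?r UNIV) \<le> y"
    using norm_infsum_bound[OF r(1)] r(2) by linarith
  moreover have "y' < cmod (sum ?b F)"
    using big by (simp only: mult.assoc)
  \<comment> \<open>Reverse triangle inequality with \<open>u\<close> the nonlinear correction,
    \<open>v\<close> the sum over \<open>F\<close> and \<open>x\<close> the linear tail.\<close>
  moreover have "cmod v \<le> cmod (u + (v + x)) + cmod u + cmod x" for u v x :: complex
    using norm_triangle_ineq4[of "u + (v + x)" "u + x"] norm_triangle_ineq[of u x]
    by (simp add: algebra_simps)
  ultimately have "z < cmod (quasi_periodic blk freq (C T) 0)"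
    using y by (smt (verit))
  also have "\<dots> \<le> (SUP x. cmod (quasi_periodic blk freq (C T) x))"
    by (rule cSUP_upper[OF UNIV_I bdd_aboveI2], rule norm_quasi_periodic_le[OF C(2)])
  finally show False using wE C(1) w E by (auto simp: sup_exceeds_event_def)
qed

end

subsection \<open>Logarithmic asymptotics\<close>

text \<open>A strictly larger exponential rate absorbs any constant prefactors as \<epsilon> tends
  to 0.\<close>

lemma eventually_exp_le:
  fixes p q :: real
  assumes "p < q" and "0 < a"
  shows "\<forall>\<^sub>F \<epsilon> in at_right 0. b * exp (- (q / \<epsilon>)) \<le> a * exp (- (p / \<epsilon>))"
proof -
  have "((\<lambda>\<epsilon>. b * exp (- ((q - p) / \<epsilon>))) \<longlongrightarrow> 0) (at_right 0)"
    using assms(1) by real_asymp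
  then have "\<forall>\<^sub>F \<epsilon> in at_right 0. b * exp (- ((q - p) / \<epsilon>)) < a"
    using assms(2) by (rule order_tendstoD)
  then show ?thesis
  proof eventually_elim
    case (elim \<epsilon>)
    have "b * exp (- (q / \<epsilon>)) = b * exp (- ((q - p) / \<epsilon>)) * exp (- (p / \<epsilon>))"
      by (simp add: exp_add[symmetric] diff_divide_distrib)
    also have "\<dots> \<le> a * exp (- (p / \<epsilon>))"
      using elim by (intro mult_right_mono) auto
    finally show ?case .
  qed
qed

lemma tendsto_eps_ln:
  fixes P :: "real \<Rightarrow> real"
  assumes upper: "\<And>q. q < I \<Longrightarrow> \<forall>\<^sub>F \<epsilon> in at_right 0. P \<epsilon> \<le> exp (- (q / \<epsilon>))"
    and lower: "\<And>p. I < p \<Longrightarrow> \<forall>\<^sub>F \<epsilon> in at_right 0. exp (- (p / \<epsilon>)) \<le> P \<epsilon>"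
  shows "((\<lambda>\<epsilon>. \<epsilon> * ln (P \<epsilon>)) \<longlongrightarrow> - I) (at_right 0)"
proof (rule order_tendstoI)
  have pos: "\<forall>\<^sub>F \<epsilon>::real in at_right 0. 0 < \<epsilon>" by (rule eventually_at_right_less)
  fix a
  {
    assume "a < - I"
    then obtain p where p: "I < p" "p < - a" using dense[of I "- a"] by auto
    from lower[OF p(1)] pos show "\<forall>\<^sub>F \<epsilon> in at_right 0. a < \<epsilon> * ln (P \<epsilon>)"
    proof eventually_elim
      case (elim \<epsilon>)
      have "0 < P \<epsilon>" using elim(1) exp_gt_zero less_le_trans by blast
      with elim(1) have "- (p / \<epsilon>) \<le> ln (P \<epsilon>)" by (simp add: ln_ge_iff)
      then have "\<epsilon> * (- (p / \<epsilon>)) \<le> \<epsilon> * ln (P \<epsilon>)" using elim(2) by (intro mult_left_mono) auto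
      with p elim(2) show ?case by simp
    qed
  next
    assume "- I < a"
    then obtain q where q: "q < I" "- a < q" using dense[of "- a" I] by auto
    \<comment> \<open>The lower bound at the arbitrary rate \<open>I + 1\<close> only supplies
      \<open>0 < P \<epsilon>\<close>, which makes \<open>ln\<close> monotone here.\<close>
    have "I < I + 1" by simp
    from upper[OF q(1)] lower[OF this] pos show "\<forall>\<^sub>F \<epsilon> in at_right 0. \<epsilon> * ln (P \<epsilon>) < a"
    proof eventually_elim
      case (elim \<epsilon>)
      have "0 < P \<epsilon>" using elim(2) exp_gt_zero less_le_trans by blast
      with elim(1) have "ln (P \<epsilon>) \<le> - (q / \<epsilon>)" by (metis ln_exp ln_le_cancel_iff exp_gt_zero)
      then have "\<epsilon> * ln (P \<epsilon>) \<le> \<epsilon> * (- (q / \<epsilon>))" using elim(3) by (intro mult_left_mono) auto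
      with q elim(3) show ?case by simp
    qed
  }
qed

section \<open>Upper and lower large deviation bounds for the exceedance events\<close>

context prob_space
begin

context
  fixes blk :: "'k::finite \<Rightarrow> 'd::finite" and freq :: "real ^ 'k" and c :: "int ^ 'k \<Rightarrow> complex"
    and g :: "int ^ 'k \<Rightarrow> 'a \<Rightarrow> complex" and \<alpha> z0 :: real and t :: "real \<Rightarrow> real" and E :: "real \<Rightarrow> 'a set"
  assumes indep: "indep_vars (\<lambda>_. borel) g UNIV" and X: "\<And>n. std_complex_gaussian (g n)"
    and c: "(\<lambda>n. cmod (c n)) summable_on UNIV" "\<And>n. cmod (c n) \<le> 1" and c_nz: "\<exists>n. c n \<noteq> 0"
    and z0: "0 < z0" and t: "\<forall>\<^sub>F \<epsilon> in at_right 0. 0 < t \<epsilon>"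
    and r: "((\<lambda>\<epsilon>. \<epsilon> powr \<alpha> * t \<epsilon> / \<epsilon>) \<longlongrightarrow> 0) (at_right 0)"
    and E: "\<forall>\<^sub>F \<epsilon> in at_right 0.
      sup_exceeds_event M blk freq \<alpha> \<epsilon> (t \<epsilon>) c g (z0 * \<epsilon> powr (- 1 / 2)) (E \<epsilon>)"
begin

abbreviation (input) S where "S \<equiv> \<Sum>\<^sub>\<infinity>n. (cmod (c n))\<^sup>2"

lemma square_summable: "(\<lambda>n. (cmod (c n))\<^sup>2) summable_on UNIV"
  by (rule summable_on_comparison_test[OF c(1)])
    (use c(2) in \<open>auto simp: power2_eq_square mult_left_le\<close>)

lemma S_pos: "0 < S"
proof -
  obtain n where "c n \<noteq> 0" using c_nz by blast
  then have "0 < sum (\<lambda>n. (cmod (c n))\<^sup>2) {n}" by simp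
  moreover have "sum (\<lambda>n. (cmod (c n))\<^sup>2) {n} \<le> S"
    by (rule finite_sum_le_infsum[OF square_summable]) auto
  ultimately show ?thesis by (rule less_le_trans)
qed

text \<open>At l1 size \<open>K * \<epsilon> powr (- 1 / 2)\<close> the square produces the factor
  1/\<epsilon>, so both quantities are a constant times the ratio in \<open>r\<close>, the second
  one on the scale of the threshold.\<close>

lemma eventually_small:
  assumes "0 < \<delta>"
  shows "\<forall>\<^sub>F \<epsilon> in at_right 0. 0 < \<epsilon> \<and>
    8 * (\<epsilon> powr \<alpha> * t \<epsilon>) * (K * \<epsilon> powr (- 1 / 2))\<^sup>2 \<le> 1 \<and>
    8 * (\<epsilon> powr \<alpha> * t \<epsilon>) * (K * \<epsilon> powr (- 1 / 2)) ^ 3 \<le> \<delta> * \<epsilon> powr (- 1 / 2) \<and>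
    (\<epsilon> powr (- 1 / 2))\<^sup>2 = 1 / \<epsilon>"
proof -
  have "((\<lambda>\<epsilon>. 8 * K\<^sup>2 * (\<epsilon> powr \<alpha> * t \<epsilon> / \<epsilon>)) \<longlongrightarrow> 0) (at_right 0)"
    "((\<lambda>\<epsilon>. 8 * K ^ 3 * (\<epsilon> powr \<alpha> * t \<epsilon> / \<epsilon>)) \<longlongrightarrow> 0) (at_right 0)"
    by (intro tendsto_mult_right_zero r)+
  from order_tendstoD(2)[OF this(1) zero_less_one] order_tendstoD(2)[OF this(2) assms]
    eventually_at_right_less[of 0]
  show ?thesis
  proof eventually_elim
    case (elim \<epsilon>)
    have sq: "(\<epsilon> powr (- 1 / 2))\<^sup>2 = 1 / \<epsilon>"
      using elim(3) by (simp add: power2_eq_square powr_add[symmetric] powr_minus_divide)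
    have "8 * (\<epsilon> powr \<alpha> * t \<epsilon>) * (K * \<epsilon> powr (- 1 / 2)) ^ 3
        = 8 * K ^ 3 * (\<epsilon> powr \<alpha> * t \<epsilon> * (\<epsilon> powr (- 1 / 2))\<^sup>2) * \<epsilon> powr (- 1 / 2)"
      by (simp add: power2_eq_square power3_eq_cube)
    also have "\<dots> \<le> \<delta> * \<epsilon> powr (- 1 / 2)"
      using elim(2) unfolding sq by (intro mult_right_mono) auto
    finally have 3: "8 * (\<epsilon> powr \<alpha> * t \<epsilon>) * (K * \<epsilon> powr (- 1 / 2)) ^ 3 \<le> \<delta> * \<epsilon> powr (- 1 / 2)" .
    have "8 * (\<epsilon> powr \<alpha> * t \<epsilon>) * (K * \<epsilon> powr (- 1 / 2))\<^sup>2 = 8 * K\<^sup>2 * (\<epsilon> powr \<alpha> * t \<epsilon> / \<epsilon>)"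
      unfolding power_mult_distrib sq by simp
    with elim 3 sq show ?case by simp
  qed
qed

lemma event_prob_upper:
  assumes q: "q < z0\<^sup>2 / S"
  shows "\<forall>\<^sub>F \<epsilon> in at_right 0. prob (E \<epsilon>) \<le> exp (- (q / \<epsilon>))"
proof -
  \<comment> \<open>\<open>q\<close> may be negative, while the auxiliary rate \<open>q'\<close>
    must be positive. The room between \<open>q\<close> and \<open>q'\<close> absorbs the prefactor
    \<open>B\<close>.\<close>
  have "max q 0 < z0\<^sup>2 / S" using q z0 S_pos by simp
  then obtain q' where q': "max q 0 < q'" "q' < z0\<^sup>2 / S" using dense by blast
  then have q0: "0 < q'" "q < q'" by auto
  \<comment> \<open>\<open>V\<close> is taken so that the level \<open>sqrt (q' * V)\<close>, whose
    tail has rate \<open>q'\<close>, lies below \<open>z0\<close>; the gap is the allowance for the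
    nonlinear error.\<close>
  have "S < z0\<^sup>2 / q'" using q' q0 S_pos by (simp add: field_simps)
  then obtain V where V: "S < V" "V < z0\<^sup>2 / q'" using dense by blast
  have V0: "0 < V" using V S_pos by linarith
  have "q' * V < z0\<^sup>2" using V q0 by (simp add: field_simps)
  then have lt: "sqrt (q' * V) < z0" using z0 real_sqrt_less_mono by fastforce
  obtain B where B: "0 < B" "\<And>z. 0 \<le> z \<Longrightarrow> prob (l1_exceeds c g z) \<le> B * exp (- (z\<^sup>2 / V))"
    using l1_exceeds_tail[OF indep X c V(1)] by blast
  have "0 < z0 - sqrt (q' * V)" using lt by simp
  from eventually_small[OF this, of z0] t E eventually_exp_le[OF q0(2) zero_less_one, of B]
  show ?thesis
  proof eventually_elim
    case (elim \<epsilon>)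
    let ?x = "\<epsilon> powr (- 1 / 2)"
    have "E \<epsilon> \<subseteq> l1_exceeds c g (sqrt (q' * V) * ?x)"
      by (rule event_subset_l1_exceeds[OF elim(3), where K = "z0 * ?x"])
        (use elim lt in \<open>auto simp: left_diff_distrib\<close>)
    then have "prob (E \<epsilon>) \<le> prob (l1_exceeds c g (sqrt (q' * V) * ?x))"
      by (rule finite_measure_mono)
        (use X in \<open>auto intro!: l1_exceeds_measurable simp: std_complex_gaussian_def\<close>)
    also have "\<dots> \<le> B * exp (- ((sqrt (q' * V) * ?x)\<^sup>2 / V))"
      using q0 V0 by (intro B) auto
    also have "(sqrt (q' * V) * ?x)\<^sup>2 / V = q' / \<epsilon>"
      using elim q0 V0 by (simp add: power_mult_distrib)
    also have "B * exp (- (q' / \<epsilon>)) \<le> exp (- (q / \<epsilon>))" using elim by simp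
    finally show ?case .
  qed
qed

lemma event_prob_lower:
  assumes p: "z0\<^sup>2 / S < p"
  shows "\<forall>\<^sub>F \<epsilon> in at_right 0. exp (- (p / \<epsilon>)) \<le> prob (E \<epsilon>)"
proof -
  have p0: "0 < p" using p z0 S_pos by (meson divide_pos_pos less_trans zero_less_power)
  obtain p' where p': "z0\<^sup>2 / S < p'" "p' < p" using p dense by blast
  define z1 where "z1 = sqrt (p' * S)"
  have "z0\<^sup>2 < p' * S" using p' S_pos by (simp add: field_simps)
  then have z1: "z0 < z1" "z1\<^sup>2 = p' * S"
    using z0 by (auto simp: z1_def real_less_rsqrt intro: order.trans[OF zero_le_power2 less_imp_le])
  \<comment> \<open>The slack pays for the linear tail, the nonlinear error and the shift by 1 in
    the Gaussian bound, each at most \<open>y\<close> on the scale of the threshold.\<close>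
  define y where "y = (z1 - z0) / 4"
  have y: "0 < y" using z1 by (simp add: y_def)
  \<comment> \<open>\<open>V\<close> and \<open>K\<close> give both exceptional l1 events the rate
    \<open>p + 1\<close>, faster than the main term.\<close>
  define V where "V = y\<^sup>2 / (p + 1)"
  have V: "0 < V" "y\<^sup>2 / V = p + 1" using y p0 by (auto simp: V_def)
  define K where "K = sqrt ((p + 1) * (S + 1))"
  have K: "0 \<le> K" "K\<^sup>2 / (S + 1) = p + 1" using p0 S_pos by (auto simp: K_def)
  \<comment> \<open>\<open>F0\<close> must capture so much of \<open>S\<close> that the Gaussian sum
    has rate below \<open>p\<close> and the remaining square sum is below \<open>V\<close>.\<close>
  have "max (p' * S / p) (S - V) < S"
    using p' p0 S_pos V by (simp add: field_simps)
  then have "\<exists>F. finite F \<and> max (p' * S / p) (S - V) < (\<Sum>n\<in>F. (cmod (c n))\<^sup>2)"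
    using infsum_le_finite_sums[OF square_summable, of "max (p' * S / p) (S - V)"] not_less by blast
  then obtain F0 where F0: "finite F0" "max (p' * S / p) (S - V) < (\<Sum>n\<in>F0. (cmod (c n))\<^sup>2)" by blast
  \<comment> \<open>Zero coefficients are dropped to keep the summands nondegenerate.\<close>
  define F where "F = {n \<in> F0. c n \<noteq> 0}"
  define S' where "S' = (\<Sum>n\<in>F. (cmod (c n))\<^sup>2)"
  have "(\<Sum>n\<in>F0. (cmod (c n))\<^sup>2) = S'"
    unfolding S'_def F_def by (intro sum.mono_neutral_right F0) auto
  with F0 have F: "finite F" and S': "p' * S / p < S'" "S - V < S'" by (auto simp: F_def)
  have p'0: "0 < p'" using p' z0 S_pos by (meson divide_pos_pos less_trans zero_less_power)
  have S'0: "0 < S'"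
    using S'(1) p'0 p0 S_pos by (meson divide_pos_pos less_trans mult_pos_pos)
  then have F_ne: "F \<noteq> {}" by (auto simp: S'_def)
  have rate: "z1\<^sup>2 / S' < p" using S'(1) S'0 p0 by (simp add: z1 field_simps)
  let ?c' = "\<lambda>n. if n \<in> F then 0 else c n"
  have c': "(\<lambda>n. cmod (?c' n)) summable_on UNIV" "\<And>n. cmod (?c' n) \<le> 1"
    using c by (auto intro: summable_on_comparison_test[OF c(1)])
  have "((\<lambda>n. if n \<in> F then (cmod (c n))\<^sup>2 else 0) has_sum S') UNIV"
    unfolding S'_def using F by (intro has_sum_finite_neutralI) auto
  from has_sum_diff[OF has_sum_infsum[OF square_summable] this]
  have "((\<lambda>n. (cmod (?c' n))\<^sup>2) has_sum (S - S')) UNIV"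
    by (rule has_sum_cong[THEN iffD1, rotated]) auto
  then have "(\<Sum>\<^sub>\<infinity>n. (cmod (?c' n))\<^sup>2) < V"
    using S'(2) infsumI by fastforce
  from l1_exceeds_tail[OF indep X c' this]
  obtain B1 where B1: "0 < B1" "\<And>z. 0 \<le> z \<Longrightarrow> prob (l1_exceeds ?c' g z) \<le> B1 * exp (- (z\<^sup>2 / V))"
    by blast
  have "S < S + 1" by simp
  from l1_exceeds_tail[OF indep X c this]
  obtain B2 where B2: "0 < B2" "\<And>z. 0 \<le> z \<Longrightarrow> prob (l1_exceeds c g z) \<le> B2 * exp (- (z\<^sup>2 / (S + 1)))"
    by blast
  \<comment> \<open>The prefactor of the Gaussian lower bound. Of its three thirds, two absorb the
    exceptional events and the last dominates \<open>exp (- (p / \<epsilon>))\<close>.\<close>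
  define A where "A = 1 / sqrt (pi * S')"
  have A: "0 < A / 3" using S'0 by (simp add: A_def)
  have lt: "z1\<^sup>2 / S' < p + 1" using rate by linarith
  have "filterlim (\<lambda>\<epsilon>::real. y * \<epsilon> powr (- 1 / 2)) at_top (at_right 0)"
    using y by real_asymp
  then have "\<forall>\<^sub>F \<epsilon> in at_right 0. 1 \<le> y * \<epsilon> powr (- 1 / 2)"
    by (simp add: filterlim_at_top)
  with eventually_small[OF y, of K] t E eventually_exp_le[OF rate A, of 1]
    eventually_exp_le[OF lt A, of B1] eventually_exp_le[OF lt A, of B2]
  show ?thesis
  proof eventually_elim
    case (elim \<epsilon>)
    let ?x = "\<epsilon> powr (- 1 / 2)"
    let ?e = "\<lambda>n. exp (- \<i> * of_real (Qform blk freq n * t \<epsilon>))"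
    let ?W = "{w \<in> space M. (z0 + 2 * y) * ?x < cmod (\<Sum>n\<in>F. ?e n * c n * g n w)}"
    have meas: "l1_exceeds c' g z \<in> events" for c' z
      using X by (intro l1_exceeds_measurable) (simp add: std_complex_gaussian_def)
    have E_meas: "E \<epsilon> \<in> events" using elim by (simp add: sup_exceeds_event_def)
    have "?W \<subseteq> E \<epsilon> \<union> l1_exceeds ?c' g (y * ?x) \<union> l1_exceeds c g (K * ?x)"
      by (rule finite_sum_event_subset[OF elim(3) _ _ _ F]) (use elim in \<open>auto simp: algebra_simps\<close>)
    then have "prob ?W \<le> prob (E \<epsilon> \<union> l1_exceeds ?c' g (y * ?x) \<union> l1_exceeds c g (K * ?x))"
      by (rule finite_measure_mono) (intro sets.Un E_meas meas)
    also have "\<dots> \<le> prob (E \<epsilon> \<union> l1_exceeds ?c' g (y * ?x)) + prob (l1_exceeds c g (K * ?x))"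
      by (intro measure_Un_le sets.Un E_meas meas)
    also have "prob (E \<epsilon> \<union> l1_exceeds ?c' g (y * ?x)) \<le> prob (E \<epsilon>) + prob (l1_exceeds ?c' g (y * ?x))"
      by (intro measure_Un_le E_meas meas)
    finally have le: "prob ?W \<le> prob (E \<epsilon>) + prob (l1_exceeds ?c' g (y * ?x)) + prob (l1_exceeds c g (K * ?x))"
      by simp
    have "prob (l1_exceeds ?c' g (y * ?x)) \<le> B1 * exp (- ((y * ?x)\<^sup>2 / V))"
      using y by (intro B1) simp
    also have "(y * ?x)\<^sup>2 / V = (p + 1) / \<epsilon>"
      using elim V(2)[symmetric] by (simp add: power_mult_distrib mult.commute)
    finally have l1: "prob (l1_exceeds ?c' g (y * ?x)) \<le> B1 * exp (- ((p + 1) / \<epsilon>))" .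
    have "prob (l1_exceeds c g (K * ?x)) \<le> B2 * exp (- ((K * ?x)\<^sup>2 / (S + 1)))"
      using K by (intro B2) simp
    also have "(K * ?x)\<^sup>2 / (S + 1) = (p + 1) / \<epsilon>"
      using elim K(2)[symmetric] by (simp add: power_mult_distrib mult.commute)
    finally have l2: "prob (l1_exceeds c g (K * ?x)) \<le> B2 * exp (- ((p + 1) / \<epsilon>))" .
    have norm_e: "(\<Sum>n\<in>F. (cmod (?e n * c n))\<^sup>2) = S'" by (simp add: S'_def norm_mult)
    have nonneg: "0 \<le> (z0 + 2 * y) * ?x" using z0 y by simp
    have nz: "?e n * c n \<noteq> 0" if "n \<in> F" for n using that by (simp add: F_def)
    have "((z0 + 2 * y) * ?x + 1)\<^sup>2 \<le> (z1 * ?x)\<^sup>2"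
    proof (rule power_mono)
      show "(z0 + 2 * y) * ?x + 1 \<le> z1 * ?x"
        using elim(7) y by (simp add: y_def field_simps)
    qed (use nonneg in simp)
    also have "\<dots> = z1\<^sup>2 / \<epsilon>" using elim by (simp add: power_mult_distrib)
    finally have "((z0 + 2 * y) * ?x + 1)\<^sup>2 / S' \<le> z1\<^sup>2 / \<epsilon> / S'"
      using S'0 by (intro divide_right_mono) auto
    then have "A * exp (- (z1\<^sup>2 / S' / \<epsilon>)) \<le> A * exp (- (((z0 + 2 * y) * ?x + 1)\<^sup>2 / S'))"
      using A by (intro mult_left_mono) (auto simp: divide_divide_eq_left mult.commute)
    also have "\<dots> \<le> prob ?W"
      using gaussian_sum_tail_ge[where a = "\<lambda>n. ?e n * c n", OF F F_ne indep_vars_subset[OF indep subset_UNIV] X nz nonneg]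
      unfolding norm_e A_def by simp
    finally show ?case using le l1 l2 elim(4-6) by simp
  qed
qed

lemma event_large_deviation:
  "((\<lambda>\<epsilon>. \<epsilon> * ln (prob (E \<epsilon>))) \<longlongrightarrow> - (z0\<^sup>2 / S)) (at_right 0)"
  by (intro tendsto_eps_ln event_prob_upper event_prob_lower)

end

end

text \<open>The exponent \<alpha> - \<beta> - 1 is positive. The limit says that the nonlinear
  effect accumulated up to the observation time vanishes relative to the linear flow.\<close>

lemma powr_mult_bigo_tendsto_0:
  fixes t :: "real \<Rightarrow> real"
  assumes t: "t \<in> O[at_right 0](\<lambda>\<epsilon>. \<epsilon> powr (- \<beta>))" and gap: "\<beta> < \<alpha> - 1"
  shows "((\<lambda>\<epsilon>. \<epsilon> powr \<alpha> * t \<epsilon> / \<epsilon>) \<longlongrightarrow> 0) (at_right 0)"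
proof -
  have "(\<lambda>\<epsilon>. \<epsilon> powr \<alpha> * t \<epsilon> / \<epsilon>) \<in> O[at_right 0](\<lambda>\<epsilon>. \<epsilon> powr \<alpha> * \<epsilon> powr (- \<beta>) / \<epsilon>)"
    using t by (intro landau_o.big.divide_right landau_o.big.mult_left)
      (auto simp: eventually_at_filter)
  also have "(\<lambda>\<epsilon>. \<epsilon> powr \<alpha> * \<epsilon> powr (- \<beta>) / \<epsilon>) \<in> o[at_right 0](\<lambda>_::real. 1::real)"
    using gap by real_asymp
  finally show ?thesis by (rule smalloD_tendsto[THEN tendsto_cong[THEN iffD1, rotated]]) simp
qed

theorem theorem1p6:
  fixes blk :: "'k::finite \<Rightarrow> 'd::finite"
    and freq :: "real ^ 'k"
    and \<rho> \<kappa> :: "real ^ 'k"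
    and c :: "int ^ 'k \<Rightarrow> complex"
    and M :: "'w measure"
    and g :: "int ^ 'k \<Rightarrow> 'w \<Rightarrow> complex"
    and \<alpha> z0 \<mu>1 \<mu>2 \<mu>3 \<eta> \<eta>2 \<eta>3 \<beta> :: real
    and t :: "real \<Rightarrow> real"
    and E :: "real \<Rightarrow> 'w set"
  assumes "surj blk" and "CARD('k) > CARD('d)"
    and "rationally_independent_blocks blk freq"
    and "\<And>k. \<rho> $ k > 0" and "\<And>k. \<kappa> $ k > 0" and "\<And>k. \<rho> $ k - \<kappa> $ k > 2"
    and "\<exists>n. c n \<noteq> 0" and "\<And>n. cmod (c n) \<le> weight (- \<rho>) n"
    and "prob_space M"
    and "prob_space.indep_vars M (\<lambda>_. borel) g UNIV"
    and "\<And>n. prob_space.std_complex_gaussian M (g n)"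
    and "\<alpha> > 1" and "z0 > 0"
    and "0 < \<mu>1" and "\<mu>1 < 1 / real CARD('k)"
    and "0 < \<mu>2" and "\<mu>2 < 1"
    and "0 < \<mu>3" and "\<mu>3 < 1"
    and "\<eta>2 = (\<Sum>k\<in>UNIV. \<rho> $ k - \<kappa> $ k - 1)"
    and "\<eta>3 = 2 / 3 * (\<alpha> - 1) - \<mu>3 / 3"
    and "0 \<le> \<eta>" and "\<eta> < min (2 * (1 / real CARD('k) - \<mu>1) * \<eta>2 - \<mu>2) \<eta>3"
    and "\<beta> = \<alpha> - 1 - 3 / 2 * \<eta> - \<mu>3 / 2"
    and "\<forall>\<^sub>F \<epsilon> in at_right 0. t \<epsilon> > 0"
    and "t \<in> O[at_right 0](\<lambda>\<epsilon>. \<epsilon> powr (- \<beta>))"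
    and "\<forall>\<^sub>F \<epsilon> in at_right 0.
           sup_exceeds_event M blk freq \<alpha> \<epsilon> (t \<epsilon>) c g (z0 * \<epsilon> powr (- 1 / 2)) (E \<epsilon>)"
  shows "((\<lambda>\<epsilon>. \<epsilon> * ln (measure M (E \<epsilon>)))
           \<longlongrightarrow> - (z0\<^sup>2 / (\<Sum>\<^sub>\<infinity>n. (cmod (c n))\<^sup>2))) (at_right 0)"
proof -
  interpret prob_space M by fact
  have "2 \<le> \<rho> $ k" for k
    using assms(5,6)[of k] by linarith
  then have "weight (- \<rho>) summable_on UNIV"
    by (rule weight_summable)
  from Infinite_Sum.abs_summable_on_comparison_test'[OF this assms(8)]
  have c_sum: "(\<lambda>n. cmod (c n)) summable_on UNIV" .
  have c_le: "cmod (c n) \<le> 1" for n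
    using assms(8)[of n] weight_le_1[of \<rho> n] assms(4) by (meson less_imp_le order_trans)
  \<comment> \<open>The gap is 3/2 \<eta> + \<mu>3/2, positive since \<mu>3 is.\<close>
  have "\<beta> < \<alpha> - 1" using assms(18,22,24) by simp
  from powr_mult_bigo_tendsto_0[OF assms(26) this]
  show ?thesis
    by (rule event_large_deviation[OF assms(10,11) c_sum c_le assms(7,13,25) _ assms(27)])
qed

end
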